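(* Let $w\in\mathcal{BC}_n$. There exists a unique ("bottom") $c$-signed pipe dream $D_b\in\mathrm{PD}_{\mathcal C_n}(w)$ with the following properties: (1) all the crosses in the staircase block are left-adjusted; (2) every nonempty $\Gamma$-block contains an elbow with a faucet in the vertical part of the block; (3) all the crosses in the $\Gamma$-blocks are located in the horizontal parts and are left-adjusted: the horizontal box indexed by $0$ contains an elbow without a faucet and is followed by a (possibly empty) sequence of crosses in the horizontal boxes $1,2,\dots$, after which there are only elbows; (4) the numbers of significant elements in the $\Gamma$-blocks $1,2,3,\dots$ form a strictly decreasing sequence (ending by zeroes). This pipe dream $D_b$ has $L_i(w)$ crosses in the $i$-th row of the staircase block and $N_j(w)$ significant elements in the $j$-th $\Gamma$-block (where $(L(w),N(w))$ is the signed Lehmer code of $w$). Any $c$-signed pipe dream $D\in\mathrm{PD}_{\mathcal C_n}(w)$ can be brought to $D_b$ by a sequence of admissible moves.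
   Context: **Group.** $\mathcal{BC}_n$ (also denoted $\mathcal C_n$) is the group of permutations $w$ of $\{\pm1,\dots,\pm n\}$ with $w(-i)=-w(i)$, generated by $s_0=(1\leftrightarrow -1)$ and $s_i=(i\leftrightarrow i+1)$ (also exchanging $-i,-(i+1)$), $1\le i\le n-1$; products are compositions of maps, $(uv)(i)=u(v(i))$. $s(w)$ is the number of $i\in\{1,\dots,n\}$ with $w(i)<0$. **Signed Lehmer code.** $L(w)=(L_1(w),\dots,L_n(w))$ with $L_i(w)=\#\{j: i<j\le n,\ w(i)>w(j)\}$, and $N(w)=(N_1(w)>\dots>N_{s(w)}(w))$ is the decreasing sequence of all $m\in\{1,\dots,n\}$ with $w^{-1}(m)<0$. **$c$-signed pipe dreams.** The base $B_{\mathcal C_n}$ consists of a staircase block and infinitely many $\Gamma$-blocks numbered $1,2,3,\dots$ from bottom to top, all lying above the staircase block. The staircase block has boxes $(i,j)$, $1\le i\le n-1$, $1\le j\le n-i$ (row $i$ from the top, column $j$ from the left; row $n$ is empty); the box $(i,j)$ is indexed by $i+j-1$. Each $\Gamma$-block has a horizontal part, one row of $n$ boxes indexed $0,1,\dots,n-1$ from left to right, and, below that row, a vertical part, one column of $n$ boxes indexed $0,1,\dots,n-1$ from top to bottom. A $c$-signed pipe dream $D$ is a filling of the base in which each box of index $0$ in a $\Gamma$-block contains either a single elbow or an elbow with a faucet, and every other box contains either a double elbow or a cross. Significant elements are crosses and elbows with a faucet; only finitely many of them are allowed. A $\Gamma$-block is nonempty if it contains a significant element. A cross in a box of index $i$ contributes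 the letter $s_i$, an elbow with a faucet the letter $s_0$, other elements contribute nothing. $\mathrm{word}(D)$ is obtained by reading the letters from top to bottom and in each row from right to left: i.e. the $\Gamma$-blocks in decreasing order of their numbers, in each of them first the horizontal part in the order of indices $n-1,\dots,0$, then the vertical part in the order $0,\dots,n-1$; then the staircase rows $1,\dots,n-1$, each from right to left. $D$ is reduced of shape $w$ if $\mathrm{word}(D)$ is a reduced word of $w$; $\mathrm{PD}_{\mathcal C_n}(w)$ is the set of all reduced $c$-signed pipe dreams of shape $w$. Crosses in a staircase row are left-adjusted if they occupy the leftmost boxes of the row. **Admissible moves.** Rows are ordered vertically: blocks with larger number lie above those with smaller number, which lie above the staircase block; within a $\Gamma$-block the row of the horizontal part lies above the vertical boxes $0,1,\dots,n-1$, which lie in successive lower rows; staircase row $i$ lies above row $i+1$. $D$ is obtained from $D'$ by an admissible move if $D,D'$ are reduced pipe dreams of the same shape which coincide except in two boxes $a,b$, the row of $a$ being strictly above the row of $b$, and either $a$ contains a cross in $D'$ and a double elbow in $D$ while $b$ contains a double elbow in $D'$ and a cross in $D$; or $a$ contains an elbow with a faucet in $D'$ and a single elbow in $D$ while $b$ contains a single elbow in $D'$ and an elbow with a faucet in $D$. *)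

theory Defs
  imports Main "HOL-Library.FuncSet" "HOL-Combinatorics.Permutations"
begin

section \<open>The hyperoctahedral group\<close>

definition signed_points :: "nat \<Rightarrow> int set" where
  "signed_points n = {- int n..int n} - {0}"

text \<open>Elements of the group are extended by the identity to all integers, so that
  multiplication is \<open>(\<circ>)\<close> and the inverse is \<open>inv\<close>.\<close>

definition BC :: "nat \<Rightarrow> (int \<Rightarrow> int) set" where
  "BC n = {w. w permutes signed_points n \<and> (\<forall>i\<in>signed_points n. w (- i) = - w i)}"

definition gen :: "nat \<Rightarrow> int \<Rightarrow> int" where
  "gen i =
    (if i = 0 then transpose 1 (- 1)
     else transpose (int i) (int i + 1) \<circ> transpose (- int i) (- (int i + 1)))"

definition word_prod :: "nat list \<Rightarrow> int \<Rightarrow> int" where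
  "word_prod u = foldr (\<lambda>i f. gen i \<circ> f) u id"

definition word_for :: "nat \<Rightarrow> (int \<Rightarrow> int) \<Rightarrow> nat list \<Rightarrow> bool" where
  "word_for n w u \<longleftrightarrow> set u \<subseteq> {..<n} \<and> word_prod u = w"

definition reduced_word :: "nat \<Rightarrow> (int \<Rightarrow> int) \<Rightarrow> nat list \<Rightarrow> bool" where
  "reduced_word n w u \<longleftrightarrow>
    word_for n w u \<and> (\<forall>v. word_for n w v \<longrightarrow> length u \<le> length v)"


section \<open>The signed Lehmer code\<close>

definition num_neg :: "nat \<Rightarrow> (int \<Rightarrow> int) \<Rightarrow> nat" where
  "num_neg n w = card {i \<in> {1..n}. w (int i) < 0}"

definition code_L :: "nat \<Rightarrow> (int \<Rightarrow> int) \<Rightarrow> nat \<Rightarrow> nat" where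
  "code_L n w i = card {j. i < j \<and> j \<le> n \<and> w (int i) > w (int j)}"

definition code_N_list :: "nat \<Rightarrow> (int \<Rightarrow> int) \<Rightarrow> nat list" where
  "code_N_list n w = rev (sorted_list_of_set {m \<in> {1..n}. inv w (int m) < 0})"

text \<open>The sequence is indexed from 1 and continued by zeroes after its last term.\<close>

definition code_N :: "nat \<Rightarrow> (int \<Rightarrow> int) \<Rightarrow> nat \<Rightarrow> nat" where
  "code_N n w j = (if 1 \<le> j \<and> j \<le> num_neg n w then code_N_list n w ! (j - 1) else 0)"


section \<open>Signed pipe dreams\<close>

text \<open>\<open>Stair i j\<close> is the staircase box in row \<open>i\<close> (from the top) and column \<open>j\<close>;
  \<open>Hor k i\<close> and \<open>Ver k i\<close> are the boxes of index \<open>i\<close> in the horizontal and in the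
  vertical part of the \<open>k\<close>-th Gamma-block.\<close>

datatype box = Stair nat nat | Hor nat nat | Ver nat nat

datatype element = Single_Elbow | Faucet_Elbow | Double_Elbow | Cross

definition stair_boxes :: "nat \<Rightarrow> box set" where
  "stair_boxes n = {Stair i j | i j. 1 \<le> i \<and> i \<le> n - 1 \<and> 1 \<le> j \<and> j \<le> n - i}"

definition gamma_boxes :: "nat \<Rightarrow> nat \<Rightarrow> box set" where
  "gamma_boxes n k = Hor k ` {..<n} \<union> Ver k ` {..<n}"

definition base :: "nat \<Rightarrow> box set" where
  "base n = stair_boxes n \<union> (\<Union>k\<in>{1..}. gamma_boxes n k)"

fun box_index :: "box \<Rightarrow> nat" where
  "box_index (Stair i j) = i + j - 1"
| "box_index (Hor k i) = i"
| "box_index (Ver k i) = i"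

text \<open>Staircase boxes of the base have positive index, so index 0 occurs only in the
  Gamma-blocks.\<close>

definition allowed :: "box \<Rightarrow> element set" where
  "allowed b =
    (if box_index b = 0 then {Single_Elbow, Faucet_Elbow} else {Double_Elbow, Cross})"

type_synonym filling = "box \<Rightarrow> element"

definition significant :: "filling \<Rightarrow> box \<Rightarrow> bool" where
  "significant D b \<longleftrightarrow> D b = Cross \<or> D b = Faucet_Elbow"

text \<open>Fillings are extensional functions on the base, so that equality of fillings is
  equality of functions.\<close>

definition signed_pipe_dreams :: "nat \<Rightarrow> filling set" where
  "signed_pipe_dreams n = {D \<in> Pi\<^sub>E (base n) allowed. finite {b \<in> base n. significant D b}}"

definition gamma_count :: "nat \<Rightarrow> filling \<Rightarrow> nat \<Rightarrow> nat" where
  "gamma_count n D k = card {b \<in> gamma_boxes n k. significant D b}"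

definition gamma_nonempty :: "nat \<Rightarrow> filling \<Rightarrow> nat \<Rightarrow> bool" where
  "gamma_nonempty n D k \<longleftrightarrow> (\<exists>b\<in>gamma_boxes n k. significant D b)"

definition stair_row_count :: "nat \<Rightarrow> filling \<Rightarrow> nat \<Rightarrow> nat" where
  "stair_row_count n D i = card {j. Stair i j \<in> stair_boxes n \<and> D (Stair i j) = Cross}"

definition letters :: "filling \<Rightarrow> box \<Rightarrow> nat list" where
  "letters D b =
    (case D b of Cross \<Rightarrow> [box_index b] | Faucet_Elbow \<Rightarrow> [0] | _ \<Rightarrow> [])"

definition gamma_word :: "nat \<Rightarrow> filling \<Rightarrow> nat \<Rightarrow> nat list" where
  "gamma_word n D k =
    concat (map (letters D) (map (Hor k) (rev [0..<n]) @ map (Ver k) [0..<n]))"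

definition stair_row_word :: "nat \<Rightarrow> filling \<Rightarrow> nat \<Rightarrow> nat list" where
  "stair_row_word n D i = concat (map (letters D) (map (Stair i) (rev [1..<n - i + 1])))"

text \<open>Only the finitely many nonempty Gamma-blocks contribute letters.\<close>

definition pd_word :: "nat \<Rightarrow> filling \<Rightarrow> nat list" where
  "pd_word n D =
    concat (map (gamma_word n D) (rev (sorted_list_of_set {k. 1 \<le> k \<and> gamma_nonempty n D k})))
    @ concat (map (stair_row_word n D) [1..<n])"

definition PD :: "nat \<Rightarrow> (int \<Rightarrow> int) \<Rightarrow> filling set" where
  "PD n w = {D \<in> signed_pipe_dreams n. reduced_word n w (pd_word n D)}"


section \<open>Admissible moves\<close>

text \<open>\<open>row_above a b\<close>: the row containing \<open>a\<close> is strictly above the row containing \<open>b\<close>.\<close>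

fun row_above :: "box \<Rightarrow> box \<Rightarrow> bool" where
  "row_above (Stair i j) (Stair i' j') \<longleftrightarrow> i < i'"
| "row_above (Stair i j) (Hor k' i') \<longleftrightarrow> False"
| "row_above (Stair i j) (Ver k' i') \<longleftrightarrow> False"
| "row_above (Hor k i) (Stair i' j') \<longleftrightarrow> True"
| "row_above (Hor k i) (Hor k' i') \<longleftrightarrow> k > k'"
| "row_above (Hor k i) (Ver k' i') \<longleftrightarrow> k \<ge> k'"
| "row_above (Ver k i) (Stair i' j') \<longleftrightarrow> True"
| "row_above (Ver k i) (Hor k' i') \<longleftrightarrow> k > k'"
| "row_above (Ver k i) (Ver k' i') \<longleftrightarrow> k > k' \<or> (k = k' \<and> i < i')"

text \<open>\<open>admissible_move n D' D\<close>: the pipe dream \<open>D\<close> is obtained from \<open>D'\<close>.\<close>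

definition admissible_move :: "nat \<Rightarrow> filling \<Rightarrow> filling \<Rightarrow> bool" where
  "admissible_move n D' D \<longleftrightarrow>
    (\<exists>w\<in>BC n. D' \<in> PD n w \<and> D \<in> PD n w) \<and>
    (\<exists>a\<in>base n. \<exists>b\<in>base n. row_above a b \<and>
      (\<forall>c\<in>base n. c \<noteq> a \<and> c \<noteq> b \<longrightarrow> D c = D' c) \<and>
      ((D' a = Cross \<and> D a = Double_Elbow \<and> D' b = Double_Elbow \<and> D b = Cross) \<or>
       (D' a = Faucet_Elbow \<and> D a = Single_Elbow \<and> D' b = Single_Elbow \<and> D b = Faucet_Elbow)))"


section \<open>Bottom pipe dreams\<close>

definition stair_left_adjusted :: "nat \<Rightarrow> filling \<Rightarrow> bool" where
  "stair_left_adjusted n D \<longleftrightarrow>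
    (\<forall>i j j'. Stair i j \<in> stair_boxes n \<and> D (Stair i j) = Cross \<and> 1 \<le> j' \<and> j' < j
      \<longrightarrow> D (Stair i j') = Cross)"

definition gamma_faucets_vertical :: "nat \<Rightarrow> filling \<Rightarrow> bool" where
  "gamma_faucets_vertical n D \<longleftrightarrow>
    (\<forall>k\<ge>1. gamma_nonempty n D k \<longrightarrow> (\<exists>i<n. D (Ver k i) = Faucet_Elbow))"

definition gamma_crosses_horizontal :: "nat \<Rightarrow> filling \<Rightarrow> bool" where
  "gamma_crosses_horizontal n D \<longleftrightarrow>
    (\<forall>k\<ge>1. (\<forall>i<n. D (Ver k i) \<noteq> Cross) \<and>
      D (Hor k 0) = Single_Elbow \<and>
      (\<forall>i i'. i < n \<and> D (Hor k i) = Cross \<and> 1 \<le> i' \<and> i' < i \<longrightarrow> D (Hor k i') = Cross))"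

text \<open>Strictly decreasing as long as the terms are nonzero, and zero from then on.\<close>

definition gamma_counts_decreasing :: "nat \<Rightarrow> filling \<Rightarrow> bool" where
  "gamma_counts_decreasing n D \<longleftrightarrow>
    (\<forall>k\<ge>1. gamma_count n D (k + 1) < gamma_count n D k \<or>
      (gamma_count n D k = 0 \<and> gamma_count n D (k + 1) = 0))"

definition bottom_pipe_dream :: "nat \<Rightarrow> (int \<Rightarrow> int) \<Rightarrow> filling \<Rightarrow> bool" where
  "bottom_pipe_dream n w D \<longleftrightarrow>
    D \<in> PD n w \<and> stair_left_adjusted n D \<and> gamma_faucets_vertical n D \<and>
    gamma_crosses_horizontal n D \<and> gamma_counts_decreasing n D"

end

theory Submission
  imports Defs
begin

text \<open>
  Call \<open>i\<close> an ascent of \<open>u\<close> if \<open>u(i) < u(i+1)\<close>, or \<open>u(1) > 0\<close> when \<open>i = 0\<close>. By the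
  exchange property, a pipe dream that admits no move has an ascent at the index of \<^emph>\<open>every\<close> box,
  crossed or not, of the product of the letters read before this box. A descent produced inside a
  row is pushed one position to the right by each lower row until this becomes impossible at
  position \<open>n-1\<close>; hence no row leaves a descent behind that a lower row could see, and this forces
  the bottom shape. Conversely, multiplying out the word of a bottom pipe dream row by row gives
  its counts in terms of the signed Lehmer code, which makes it unique. Moves only lower the
  significant elements, so they terminate.
\<close>

section \<open>Words in the generators\<close>

text \<open>The exchange must lead to a lower row, not just to an earlier letter. Indices decrease
  along a row in reading order, so for a positive index the letters between two boxes of one row fix
  the point compared at the later box. This excludes an exchange inside a row, and it is the reason
  why \<open>exchange\<close> also records where that point is sent. Information then travels
  against the reading direction. Ascents are proved for the products up to a staircase row, where a
  shifted descent finally runs out of room, and are handed from each Gamma-block to the product of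
  the blocks above it. The obstacle in a Gamma-block is \<open>s_0\<close>, which may spoil the
  ascent at 1. The first vertical box makes the product before it positive at 1. If this box has no
  faucet, that product has ascents everywhere, hence is the identity, and reducedness empties the
  block and all blocks above it. If it has one, only positions from 2 on are controlled, which is
  just enough to exclude gaps. The strict decrease of the counts comes from the ascent at 1 behind a
  block: the product of the blocks above takes 1 to minus their lowest count and fixes everything
  larger than this count.\<close>

lemma gen_0: "gen 0 x = (if x = 1 then - 1 else if x = - 1 then 1 else x)"
  by (auto simp: gen_def transpose_def)

lemma gen_pos:
  assumes "i \<ge> 1"
  shows "gen i x = (if x = int i then int i + 1 else if x = int i + 1 then int i
    else if x = - int i then - int i - 1 else if x = - int i - 1 then - int i else x)"
  using assms by (auto simp: gen_def transpose_def)

lemma gen_gen [simp]: "gen i (gen i x) = x"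
  by (cases "i = 0") (auto simp: gen_0 gen_pos)

lemma gen_comp_gen [simp]: "gen i \<circ> gen i = id"
  by (simp add: fun_eq_iff)

lemma gen_minus: "gen i (- x) = - gen i x"
  by (cases "i = 0") (auto simp: gen_0 gen_pos)

lemma inj_gen: "inj (gen i)"
  by (rule injI) (metis gen_gen)

lemma word_prod_Nil [simp]: "word_prod [] = id"
  by (simp add: word_prod_def)

lemma word_prod_Cons [simp]: "word_prod (i # u) = gen i \<circ> word_prod u"
  by (simp add: word_prod_def)

lemma word_prod_append [simp]: "word_prod (u @ v) = word_prod u \<circ> word_prod v"
  by (induction u) (auto simp: comp_assoc)

lemma word_prod_minus: "word_prod u (- x) = - word_prod u x"
  by (induction u) (auto simp: gen_minus)

lemma inj_word_prod: "inj (word_prod u)"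
proof (induction u)
  case (Cons i u)
  then show ?case unfolding word_prod_Cons by (intro inj_compose inj_gen)
qed simp

lemma word_prod_zero [simp]: "word_prod u 0 = 0"
  using word_prod_minus[of u 0] by simp

lemma word_prod_eq_iff [simp]: "word_prod u x = word_prod u y \<longleftrightarrow> x = y"
  using inj_word_prod[of u] by (auto simp: inj_def)

lemma word_prod_fixes:
  assumes "p \<ge> 1" "\<forall>i\<in>set u. i \<noteq> p \<and> Suc i \<noteq> p"
  shows "word_prod u (int p) = int p"
  using assms(2)
proof (induction u)
  case (Cons i u)
  then show ?case using assms(1) by (cases "i = 0") (auto simp: gen_0 gen_pos)
qed simp

text \<open>The compared points are the neighbouring nonzero integers exchanged by
  \<open>gen i\<close>. Taking -1 and 1 at index 0 lets one exchange argument serve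
  \<open>s_0\<close> and the other generators.\<close>

definition asc :: "(int \<Rightarrow> int) \<Rightarrow> nat \<Rightarrow> bool" where
  "asc u i \<longleftrightarrow> u (if i = 0 then - 1 else int i) < u (int i + 1)"

lemma asc_pos: "i \<ge> 1 \<Longrightarrow> asc u i \<longleftrightarrow> u (int i) < u (int i + 1)"
  by (simp add: asc_def)

lemma asc_0: "(\<And>x. u (- x) = - u x) \<Longrightarrow> asc u 0 \<longleftrightarrow> u 1 > 0"
  by (auto simp: asc_def)

text \<open>A generator only swaps neighbouring nonzero integers, so it reverses no other pair; for
  positive \<open>j\<close> the mirrored negative pair occurs as well.\<close>

lemma gen_inversion:
  assumes "x < y" "x \<noteq> 0" "y \<noteq> 0" "gen j x \<ge> gen j y"
  shows "if j = 0 then x = - 1 \<and> y = 1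
    else x = int j \<and> y = int j + 1 \<or> x = - int j - 1 \<and> y = - int j"
  using assms by (cases "j = 0") (auto simp: gen_0 gen_pos split: if_splits)

text \<open>Conjugating the swap \<open>gen i\<close> by \<open>f\<close> swaps the images of the
  two points, and by oddness also their negatives; if these images are the pair of
  \<open>gen j\<close>, the conjugate is \<open>gen j\<close>.\<close>

lemma odd_intertwine:
  assumes odd: "\<And>x. f (- x) = - f x" and inj: "inj f"
    and pair: "if j = 0 then f (- 1) = - 1 \<and> i = 0
      else i \<noteq> 0 \<and> (f (int i) = int j \<and> f (int i + 1) = int j + 1
        \<or> f (int i) = - int j - 1 \<and> f (int i + 1) = - int j)"
  shows "gen j \<circ> f = f \<circ> gen i"
proof
  fix x
  have eq: "f a = f b \<longleftrightarrow> a = b" for a b using inj by (auto simp: inj_def)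
  show "(gen j \<circ> f) x = (f \<circ> gen i) x"
  proof (cases "j = 0")
    case True
    then have f1: "f (- 1) = - 1" "f 1 = 1" "i = 0" using pair odd[of "1"] by auto
    then show ?thesis using True
      using eq[of x 1] eq[of x "- 1"] by (auto simp: gen_0)
  next
    case False
    let ?a = "int i" and ?b = "int i + 1"
    have i: "i \<ge> 1" and pr: "f ?a = int j \<and> f ?b = int j + 1 \<or> f ?a = - int j - 1 \<and> f ?b = - int j"
      using pair False by auto
    have m: "f (- ?a) = - f ?a" "f (- ?b) = - f ?b" by (rule odd)+
    have oth: "f x \<noteq> f ?a" "f x \<noteq> f ?b" "f x \<noteq> - f ?a" "f x \<noteq> - f ?b"
      if "x \<notin> {?a, ?b, - ?a, - ?b}"
      using that unfolding m[symmetric] eq by blast+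
    consider "x = ?a" | "x = ?b" | "x = - ?a" | "x = - ?b" | "x \<notin> {?a, ?b, - ?a, - ?b}" by blast
    then show ?thesis
    proof cases
      case 5
      then have "gen i x = x" using i by (auto simp: gen_pos)
      moreover have "gen j (f x) = f x" using oth[OF 5] pr False by (simp add: gen_pos) auto
      ultimately show ?thesis by simp
    qed (use pr m i False in \<open>auto simp: gen_pos\<close>)
  qed
qed

text \<open>Reading the word from its right end, the images of the two points compared by \<open>asc\<close>
  exchange their order at some letter, and that letter is the one to be deleted.\<close>

lemma exchange:
  fixes ix :: "'a \<Rightarrow> nat"
  assumes "\<not> asc (word_prod (map ix xs)) i"
  obtains xs1 a xs2 where "xs = xs1 @ a # xs2"
    and "word_prod (map ix (xs1 @ xs2)) = word_prod (map ix xs) \<circ> gen i"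
    and "ix a = 0 \<longleftrightarrow> i = 0"
    and "i = 0 \<or> word_prod (map ix xs2) (int i) \<in> {int (ix a), - int (ix a) - 1}"
  using assms
proof (induction xs arbitrary: thesis)
  case Nil
  then show ?case by (auto simp: asc_def split: if_splits)
next
  case (Cons x xs)
  show ?case
  proof (cases "asc (word_prod (map ix xs)) i")
    case False
    obtain xs1 a xs2 where "xs = xs1 @ a # xs2"
      and "word_prod (map ix (xs1 @ xs2)) = word_prod (map ix xs) \<circ> gen i"
      and "ix a = 0 \<longleftrightarrow> i = 0"
      and "i = 0 \<or> word_prod (map ix xs2) (int i) \<in> {int (ix a), - int (ix a) - 1}"
      using Cons.IH[OF _ False] by blast
    then show ?thesis by (intro Cons.prems(1)[of "x # xs1" a xs2]) (auto simp: comp_assoc)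
  next
    case True
    let ?f = "word_prod (map ix xs)" and ?j = "ix x" and ?x = "if i = 0 then - 1 else int i"
    have nz: "?f y \<noteq> 0" if "y \<noteq> 0" for y
      using that word_prod_eq_iff[of "map ix xs" y 0] by simp
    \<comment> \<open>The tail ascends at \<open>i\<close> and the whole word does not, so the two
      images form a pair reversed by the letter \<open>?j\<close>. This also locates the image of
      \<open>i\<close>, which later separates boxes of one row.\<close>
    have *: "if ?j = 0 then ?f ?x = - 1 \<and> ?f (int i + 1) = 1
      else ?f ?x = int ?j \<and> ?f (int i + 1) = int ?j + 1
        \<or> ?f ?x = - int ?j - 1 \<and> ?f (int i + 1) = - int ?j"
      using True Cons.prems(2) by (intro gen_inversion nz) (auto simp: asc_def)
    have m: "?f (- y) = - ?f y" for y by (rule word_prod_minus)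
    have j0: "?j = 0 \<longleftrightarrow> i = 0"
    proof
      assume "?j = 0"
      then have "?f ?x = ?f (- (int i + 1))" using * unfolding m by simp
      then have "?x = - (int i + 1)" unfolding word_prod_eq_iff .
      then show "i = 0" by (auto split: if_splits)
    next
      assume "i = 0"
      then show "?j = 0" using * m[of 1] by (auto split: if_splits)
    qed
    have "gen ?j \<circ> ?f = ?f \<circ> gen i"
      using * j0 by (intro odd_intertwine word_prod_minus inj_word_prod) (auto split: if_splits)
    then have del: "?f = (gen ?j \<circ> ?f) \<circ> gen i" by (simp add: comp_assoc)
    show ?thesis
    proof (rule Cons.prems(1)[of "[]" x xs])
      show "word_prod (map ix ([] @ xs)) = word_prod (map ix (x # xs)) \<circ> gen i"
        unfolding append_Nil list.map word_prod_Cons by (rule del)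
    qed (use * j0 in \<open>auto split: if_splits\<close>)
  qed
qed

text \<open>At a descent the exchange deletes a letter of \<open>u\<close> and absorbs
  \<open>i\<close>, so the word would be two letters too long.\<close>

lemma reduced_word_asc:
  assumes "reduced_word n w (u @ i # v)"
  shows "asc (word_prod u) i"
proof (rule ccontr)
  assume "\<not> asc (word_prod u) i"
  then have "\<not> asc (word_prod (map id u)) i" by simp
  then obtain u1 a u2 where u: "u = u1 @ a # u2"
    and eq: "word_prod (map id (u1 @ u2)) = word_prod (map id u) \<circ> gen i"
    by (rule exchange) blast
  have "word_for n w (u1 @ u2 @ v)"
  proof -
    have "word_prod (u1 @ u2 @ v) = word_prod u \<circ> gen i \<circ> word_prod v"
      using eq by (metis append_assoc list.map_id word_prod_append)
    then show ?thesis
      using assms u by (auto simp: reduced_word_def word_for_def comp_assoc)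
  qed
  then show False using assms u unfolding reduced_word_def by fastforce
qed

lemma reduced_word_prefix_Nil:
  assumes "reduced_word n w (u @ v)" "word_prod u = id"
  shows "u = []"
proof -
  have "word_for n w v" using assms by (auto simp: reduced_word_def word_for_def)
  then show ?thesis using assms(1) unfolding reduced_word_def by fastforce
qed


section \<open>Generation of the group\<close>

lemma BC_minus: "w \<in> BC n \<Longrightarrow> w (- x) = - w x"
  by (cases "x \<in> signed_points n")
    (auto simp: BC_def permutes_def signed_points_def)

lemma BC_comp: "v \<in> BC n \<Longrightarrow> w \<in> BC n \<Longrightarrow> v \<circ> w \<in> BC n"
  unfolding BC_def by (auto intro: permutes_compose simp: permutes_in_image)

lemma gen_in_BC:
  assumes "i < n"
  shows "gen i \<in> BC n"
proof -
  have "gen i permutes signed_points n"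
    unfolding permutes_def
  proof (intro conjI allI impI)
    fix x assume "x \<notin> signed_points n"
    then show "gen i x = x" using assms
      by (cases "i = 0") (auto simp: gen_0 gen_pos signed_points_def)
  next
    fix y show "\<exists>!x. gen i x = y" by (metis gen_gen)
  qed
  then show ?thesis by (simp add: BC_def gen_minus)
qed

lemma word_prod_in_BC: "set u \<subseteq> {..<n} \<Longrightarrow> word_prod u \<in> BC n"
proof (induction u)
  case Nil
  show ?case using permutes_id unfolding BC_def word_prod_Nil by fastforce
next
  case (Cons i u)
  then show ?case unfolding word_prod_Cons by (intro BC_comp gen_in_BC) auto
qed

lemma BC_bounded: "w \<in> BC n \<Longrightarrow> 1 \<le> p \<Longrightarrow> p \<le> n \<Longrightarrow> \<bar>w (int p)\<bar> \<le> int n"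
  using permutes_in_image[of w "signed_points n" "int p"]
  by (auto simp: BC_def signed_points_def)

text \<open>Ascents make \<open>w\<close> positive and strictly increasing on 1..n, and values
  bounded by \<open>n\<close> leave only the identity there; negative arguments follow by
  oddness.\<close>

lemma BC_eq_id_if_asc:
  assumes w: "w \<in> BC n" and asc: "\<And>i. i < n \<Longrightarrow> asc w i"
  shows "w = id"
proof -
  have ge: "int p \<le> w (int p)" if "1 \<le> p" "p \<le> n" for p
    using that
  proof (induction p rule: dec_induct)
    case base
    then show ?case using asc[of 0] BC_minus[OF w] by (simp add: asc_0)
  next
    case (step p)
    then show ?case using asc[of p] by (auto simp: asc_pos add.commute)
  qed
  have le: "w (int p) \<le> int p" if "p \<le> n" "1 \<le> p" for p
    using that
  proof (induction p rule: inc_induct)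
    case base
    then show ?case using BC_bounded[OF w, of n] by simp
  next
    case (step p)
    then show ?case using asc[of p] by (auto simp: asc_pos add.commute)
  qed
  have pos: "w x = x" if "x > 0" for x
  proof (cases "x \<le> int n")
    case True
    then show ?thesis using ge[of "nat x"] le[of "nat x"] that by force
  next
    case False
    then show ?thesis using w by (auto simp: BC_def permutes_def signed_points_def)
  qed
  have "w x = x" for x
    using pos[of x] pos[of "- x"] BC_minus[OF w, of x] BC_minus[OF w, of 0]
    by (cases "x = 0"; cases "x > 0") auto
  then show ?thesis by auto
qed

text \<open>Multiplying on the right by the generator of a descent increases \<open>\<Sum>p. p * w p\<close>.\<close>

lemma BC_generated:
  assumes "w \<in> BC n"
  shows "\<exists>u. word_for n w u"
  using assms
proof (induction "nat (int n ^ 3 - (\<Sum>p\<in>{1..n}. int p * w (int p)))" arbitrary: w rule: less_induct)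
  case less
  let ?m = "\<lambda>w. \<Sum>p\<in>{1..n}. int p * w (int p)"
  have bound: "?m w \<le> int n ^ 3" if w: "w \<in> BC n" for w
  proof -
    have "?m w \<le> (\<Sum>p\<in>{1..n}. int n * int n)"
    proof (rule sum_mono)
      fix p assume "p \<in> {1..n}"
      then have "\<bar>int p * w (int p)\<bar> \<le> int n * int n"
        unfolding abs_mult using BC_bounded[OF w, of p] by (intro mult_mono) auto
      then show "int p * w (int p) \<le> int n * int n" by simp
    qed
    then show ?thesis by (simp add: power3_eq_cube)
  qed
  show ?case
  proof (cases "\<forall>i<n. asc w i")
    case True
    then have "w = id" using BC_eq_id_if_asc[OF less.prems] by blast
    then have "word_for n w []" by (auto simp: word_for_def)
    then show ?thesis ..
  next
    case False
    then obtain i where i: "i < n" "\<not> asc w i" by blast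
    let ?v = "w \<circ> gen i"
    have v: "?v \<in> BC n" using less.prems i(1) by (intro BC_comp gen_in_BC)
    have inj: "inj w" using less.prems by (auto simp: BC_def permutes_inj)
    let ?d = "\<lambda>p. int p * ?v (int p) - int p * w (int p)"
    have "?m ?v - ?m w = (\<Sum>p\<in>{1..n}. ?d p)"
      by (simp add: sum_subtractf)
    also have "\<dots> = (\<Sum>p\<in>{i, Suc i} - {0}. ?d p)"
    proof (rule sum.mono_neutral_right)
      show "\<forall>p\<in>{1..n} - ({i, Suc i} - {0}). ?d p = 0"
      proof
        fix p assume "p \<in> {1..n} - ({i, Suc i} - {0})"
        then have "p \<noteq> 0" "p \<noteq> i" "p \<noteq> Suc i" by auto
        then have "gen i (int p) = int p" using word_prod_fixes[of p "[i]"] by simp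
        then show "?d p = 0" by simp
      qed
    qed (use i(1) in auto)
    also have "\<dots> > 0"
    proof (cases "i = 0")
      case True
      have "{i, Suc i} - {0} = {1}" using True by auto
      then have "(\<Sum>p\<in>{i, Suc i} - {0}. ?d p) = w (- 1) - w 1"
        using True by (simp only: sum.insert sum.empty) (simp add: gen_0)
      moreover have "w 1 \<noteq> w (- 1)" using injD[OF inj, of 1 "- 1"] by auto
      moreover have "w 1 \<le> w (- 1)" using i(2) True by (simp add: asc_def)
      ultimately show ?thesis by linarith
    next
      case False
      have "{i, Suc i} - {0} = {i, Suc i}" using False by auto
      then have "(\<Sum>p\<in>{i, Suc i} - {0}. ?d p) = w (int i) - w (int i + 1)"
        using False by (simp add: gen_pos algebra_simps)
      moreover have "w (int i) \<noteq> w (int i + 1)" using injD[OF inj, of "int i" "int i + 1"] by auto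
      moreover have "w (int i + 1) \<le> w (int i)" using i(2) False by (simp add: asc_pos)
      ultimately show ?thesis by linarith
    qed
    finally have "?m w < ?m ?v" by simp
    then have "nat (int n ^ 3 - ?m ?v) < nat (int n ^ 3 - ?m w)"
      using bound[OF v] by linarith
    then obtain u where "word_for n ?v u" using less.hyps v by blast
    then have "word_for n w (u @ [i])"
      using i(1) by (auto simp: word_for_def comp_assoc)
    then show ?thesis ..
  qed
qed

lemma reduced_word_exists:
  assumes "w \<in> BC n"
  shows "\<exists>u. reduced_word n w u"
proof -
  obtain u where "word_for n w u" using BC_generated[OF assms] by blast
  then show ?thesis
    using ex_has_least_nat[of "word_for n w" u length] unfolding reduced_word_def by blast
qed


section \<open>Pipe dreams as sets of significant boxes\<close>

text \<open>The column of a staircase box is expressed through its index \<open>p\<close>, so that every row is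
  a list over a decreasing interval of indices.\<close>

definition stair_list :: "nat \<Rightarrow> nat \<Rightarrow> box list" where
  "stair_list n i = map (\<lambda>p. Stair i (Suc p - i)) (rev [i..<n])"

definition gamma_list :: "nat \<Rightarrow> nat \<Rightarrow> box list" where
  "gamma_list n k = map (Hor k) (rev [0..<n]) @ map (Ver k) [0..<n]"

definition stair_part :: "nat \<Rightarrow> nat \<Rightarrow> nat \<Rightarrow> box list" where
  "stair_part n a b = concat (map (stair_list n) [a..<b])"

text \<open>Higher blocks are read first, so decreasing \<open>m\<close> appends at the end of the
  list. Inductions along the reading therefore descend from \<open>m = Suc K\<close>, the empty
  part.\<close>

definition gamma_part :: "nat \<Rightarrow> nat \<Rightarrow> nat \<Rightarrow> box list" where
  "gamma_part n m K = concat (map (gamma_list n) (rev [m..<Suc K]))"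

text \<open>The reading order of the base cut off above block \<open>K\<close>. Beyond a suitable
  \<open>K\<close> a pipe dream has no letters, so a finite list can stand for the infinite
  base.\<close>

definition boxes :: "nat \<Rightarrow> nat \<Rightarrow> box list" where
  "boxes n K = gamma_part n 1 K @ stair_part n 1 n"

lemma set_gamma_list: "set (gamma_list n k) = gamma_boxes n k"
  by (auto simp: gamma_list_def gamma_boxes_def)

lemma set_stair_list:
  assumes "1 \<le> i" "i < n"
  shows "set (stair_list n i) = {Stair i j | j. 1 \<le> j \<and> j \<le> n - i}"
proof -
  have "Stair i j \<in> set (stair_list n i)" if "1 \<le> j" "j \<le> n - i" for j
    unfolding stair_list_def set_map
    by (rule image_eqI[of _ _ "i + j - 1"]) (use that assms in auto)
  then show ?thesis using assms by (auto simp: stair_list_def)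
qed

lemma stair_listD: "b \<in> set (stair_list n i) \<Longrightarrow> \<exists>j. b = Stair i j"
  by (auto simp: stair_list_def)

lemma set_gamma_part: "set (gamma_part n m K) = (\<Union>k\<in>{m..K}. gamma_boxes n k)"
  by (simp add: gamma_part_def set_gamma_list atLeastLessThanSuc_atLeastAtMost del: upt_Suc)

lemma set_boxes: "set (boxes n K) = stair_boxes n \<union> (\<Union>k\<in>{1..K}. gamma_boxes n k)"
proof -
  have "set (stair_part n 1 n) = stair_boxes n"
    by (auto simp: stair_part_def stair_boxes_def set_stair_list)
  then show ?thesis by (auto simp: boxes_def set_gamma_part)
qed

lemma set_boxes_subset: "set (boxes n K) \<subseteq> base n"
  by (auto simp: set_boxes base_def)

lemma box_index_less: "b \<in> base n \<Longrightarrow> box_index b < n"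
  by (auto simp: base_def stair_boxes_def gamma_boxes_def)

lemma gamma_part_empty: "K < m \<Longrightarrow> gamma_part n m K = []"
  by (simp add: gamma_part_def)

lemma gamma_part_step: "m \<le> K \<Longrightarrow> gamma_part n m K = gamma_part n (Suc m) K @ gamma_list n m"
  by (simp add: gamma_part_def upt_conv_Cons del: upt_Suc)

lemma gamma_part_prefix:
  assumes "1 \<le> m" "m \<le> Suc K"
  shows "\<exists>ys. gamma_part n 1 K = gamma_part n m K @ ys"
proof -
  have "[1..<Suc K] = [1..<m] @ [m..<Suc K]"
    using assms upt_add_eq_append[of 1 m "Suc K - m"] by simp
  then show ?thesis by (simp add: gamma_part_def del: upt_Suc)
qed

lemma boxes_split_gamma:
  assumes "1 \<le> k" "k \<le> K"
  shows "\<exists>ys. boxes n K = gamma_part n (Suc k) K @ gamma_list n k @ ys"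
  using gamma_part_prefix[of k K n] gamma_part_step[of k K n] assms
  by (auto simp: boxes_def)

lemma stair_part_step: "1 \<le> r \<Longrightarrow> stair_part n 1 (Suc r) = stair_part n 1 r @ stair_list n r"
  by (simp add: stair_part_def)

lemma stair_part_prefix:
  assumes "1 \<le> r" "r \<le> n"
  shows "\<exists>ys. stair_part n 1 n = stair_part n 1 r @ ys"
proof -
  have "[1..<n] = [1..<r] @ [r..<n]"
    using assms upt_add_eq_append[of 1 r "n - r"] by simp
  then show ?thesis by (simp add: stair_part_def)
qed

lemma boxes_split_stair:
  assumes "1 \<le> r" "r < n"
  shows "\<exists>ys. boxes n K = (gamma_part n 1 K @ stair_part n 1 r) @ stair_list n r @ ys"
  using stair_part_prefix[of "Suc r" n] stair_part_step[of r n] assms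
  by (auto simp: boxes_def)

section \<open>The reading order as a relation on boxes\<close>

fun same_row :: "box \<Rightarrow> box \<Rightarrow> bool" where
  "same_row (Stair i j) (Stair i' j') \<longleftrightarrow> i = i'"
| "same_row (Hor k i) (Hor k' i') \<longleftrightarrow> k = k'"
| "same_row _ _ \<longleftrightarrow> False"

text \<open>Every vertical box is a row of its own, so the second alternative concerns staircase and
  horizontal rows only. Admissible moves require the first alternative.\<close>

definition before :: "box \<Rightarrow> box \<Rightarrow> bool" where
  "before a b \<longleftrightarrow> row_above a b \<or> same_row a b \<and> box_index a > box_index b"

lemma before_irrefl: "\<not> before a a"
  by (cases a) (auto simp: before_def)

lemma before_between:
  assumes "before a c" "before c b" "same_row a b"
  shows "box_index c > box_index b"
  using assms by (cases a; cases b; cases c) (auto simp: before_def)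

lemma sorted_wrt_concat_map:
  assumes "sorted_wrt R l" "\<And>k. k \<in> set l \<Longrightarrow> sorted_wrt S (f k)"
    and "\<And>k k' x y. k \<in> set l \<Longrightarrow> k' \<in> set l \<Longrightarrow> R k k' \<Longrightarrow> x \<in> set (f k) \<Longrightarrow> y \<in> set (f k') \<Longrightarrow> S x y"
  shows "sorted_wrt S (concat (map f l))"
  using assms by (induction l) (fastforce simp: sorted_wrt_append)+

lemma sorted_boxes: "sorted_wrt before (boxes n K)"
proof -
  have g: "sorted_wrt before (gamma_list n k)" for k
    by (auto simp: gamma_list_def sorted_wrt_append sorted_wrt_map sorted_wrt_rev before_def
        intro: sorted_wrt_mono_rel[OF _ sorted_wrt_upt])
  have s: "sorted_wrt before (stair_list n i)" for i
    by (auto simp: stair_list_def sorted_wrt_map sorted_wrt_rev before_def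
        intro: sorted_wrt_mono_rel[OF _ sorted_wrt_upt])
  have "sorted_wrt before (gamma_part n 1 K)"
    unfolding gamma_part_def
    by (rule sorted_wrt_concat_map[where R = "(>)"])
      (auto simp: g sorted_wrt_rev set_gamma_list gamma_boxes_def before_def simp del: upt_Suc)
  moreover have "sorted_wrt before (stair_part n 1 n)"
    unfolding stair_part_def
    by (rule sorted_wrt_concat_map[where R = "(<)"])
      (auto simp: s before_def dest!: stair_listD)
  ultimately show ?thesis
    by (auto simp: boxes_def sorted_wrt_append before_def set_gamma_part gamma_boxes_def
        stair_part_def stair_list_def)
qed

lemma distinct_boxes: "distinct (boxes n K)"
proof -
  have "distinct xs" if "sorted_wrt before xs" for xs
    using that by (induction xs) (auto simp: before_irrefl)
  then show ?thesis using sorted_boxes by blast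
qed

text \<open>In a pipe dream a significant element always contributes the index of its box, a faucet
  having index 0; hence the word depends only on the set of significant boxes.\<close>

definition sig_word :: "filling \<Rightarrow> box list \<Rightarrow> nat list" where
  "sig_word D xs = map box_index (filter (significant D) xs)"

lemma sig_word_append [simp]: "sig_word D (xs @ ys) = sig_word D xs @ sig_word D ys"
  by (simp add: sig_word_def)

lemma sig_word_Cons:
  "sig_word D (x # xs) = (if significant D x then box_index x # sig_word D xs else sig_word D xs)"
  by (simp add: sig_word_def)

lemma sig_word_Nil [simp]: "sig_word D [] = []"
  by (simp add: sig_word_def)

lemma sig_word_eq_Nil_iff: "sig_word D xs = [] \<longleftrightarrow> (\<forall>x\<in>set xs. \<not> significant D x)"
  by (simp add: sig_word_def filter_empty_conv)

lemma sig_word_map: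
  assumes "\<And>i. i \<in> set l \<Longrightarrow> box_index (f i) = i"
  shows "sig_word D (map f l) = filter (\<lambda>i. significant D (f i)) l"
  using assms by (induction l) (auto simp: sig_word_def)

lemma set_sig_word: "set xs \<subseteq> base n \<Longrightarrow> set (sig_word D xs) \<subseteq> {..<n}"
  using box_index_less by (auto simp: sig_word_def)

lemma pipe_dream_allowed:
  "D \<in> signed_pipe_dreams n \<Longrightarrow> b \<in> base n \<Longrightarrow> D b \<in> allowed b"
  by (auto simp: signed_pipe_dreams_def)

lemma letters_eq:
  assumes "D \<in> signed_pipe_dreams n" "b \<in> base n"
  shows "letters D b = sig_word D [b]"
  using pipe_dream_allowed[OF assms]
  by (auto simp: letters_def sig_word_def significant_def allowed_def split: if_splits)

lemma concat_letters_eq: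
  assumes "D \<in> signed_pipe_dreams n" "set xs \<subseteq> base n"
  shows "concat (map (letters D) xs) = sig_word D xs"
  using assms(2)
  by (induction xs) (auto simp: letters_eq[OF assms(1)] sig_word_Cons)

lemma gamma_word_eq:
  assumes "D \<in> signed_pipe_dreams n" "1 \<le> k"
  shows "gamma_word n D k = sig_word D (gamma_list n k)"
proof -
  have "set (gamma_list n k) \<subseteq> base n"
    using assms(2) by (auto simp: set_gamma_list base_def)
  from concat_letters_eq[OF assms(1) this] show ?thesis
    by (simp add: gamma_word_def gamma_list_def)
qed

lemma stair_row_word_eq:
  assumes "D \<in> signed_pipe_dreams n" "1 \<le> i" "i < n"
  shows "stair_row_word n D i = sig_word D (stair_list n i)"
proof -
  have "map (Stair i) [1..<n - i + 1] = map (\<lambda>p. Stair i (Suc p - i)) [i..<n]"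
    by (rule nth_equalityI) (use assms in \<open>auto simp del: upt_Suc\<close>)
  then have "map (Stair i) (rev [1..<n - i + 1]) = stair_list n i"
    unfolding stair_list_def rev_map[symmetric] by simp
  moreover have "set (stair_list n i) \<subseteq> base n"
    using assms(2,3) by (auto simp: set_stair_list base_def stair_boxes_def)
  from concat_letters_eq[OF assms(1) this]
  have "concat (map (letters D) (stair_list n i)) = sig_word D (stair_list n i)" .
  ultimately show ?thesis by (simp add: stair_row_word_def)
qed

lemma concat_map_filter:
  assumes "\<And>x. x \<in> set l \<Longrightarrow> \<not> P x \<Longrightarrow> f x = []"
  shows "concat (map f (filter P l)) = concat (map f l)"
  using assms by (induction l) auto

lemma sig_word_concat: "sig_word D (concat (map f l)) = concat (map (\<lambda>x. sig_word D (f x)) l)"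
  by (induction l) auto

text \<open>Empty blocks contribute no letters, so all blocks up to any bound \<open>K\<close> may
  be read instead of the nonempty ones alone.\<close>

lemma pd_word_eq:
  assumes D: "D \<in> signed_pipe_dreams n" and K: "\<And>k. k > K \<Longrightarrow> \<not> gamma_nonempty n D k"
  shows "pd_word n D = sig_word D (boxes n K)"
proof -
  let ?P = "gamma_nonempty n D"
  have "k \<le> K" if "?P k" for k
    using K that not_less by blast
  then have "{k. 1 \<le> k \<and> ?P k} = set (filter ?P [1..<Suc K])"
    by (auto simp: less_Suc_eq_le simp del: upt_Suc)
  then have "sorted_list_of_set {k. 1 \<le> k \<and> ?P k} = filter ?P [1..<Suc K]"
    by (simp only: sorted_list_of_set.idem_if_sorted_distinct sorted_wrt_filter sorted_upt distinct_filter distinct_upt)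
  then have "concat (map (gamma_word n D) (rev (sorted_list_of_set {k. 1 \<le> k \<and> ?P k})))
      = concat (map (gamma_word n D) (filter ?P (rev [1..<Suc K])))"
    by (simp only: rev_filter)
  also have "\<dots> = concat (map (gamma_word n D) (rev [1..<Suc K]))"
  proof (rule concat_map_filter)
    fix k assume "k \<in> set (rev [1..<Suc K])" "\<not> ?P k"
    then show "gamma_word n D k = []"
      by (auto simp: gamma_word_eq[OF D] sig_word_eq_Nil_iff set_gamma_list gamma_nonempty_def)
  qed
  also have "\<dots> = sig_word D (gamma_part n 1 K)"
    unfolding gamma_part_def sig_word_concat
    by (intro arg_cong[of _ _ concat] map_cong) (auto simp: gamma_word_eq[OF D] simp del: upt_Suc)
  finally have "concat (map (gamma_word n D) (rev (sorted_list_of_set {k. 1 \<le> k \<and> ?P k})))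
      = sig_word D (gamma_part n 1 K)" .
  moreover have "concat (map (stair_row_word n D) [1..<n]) = sig_word D (stair_part n 1 n)"
    unfolding stair_part_def sig_word_concat
    by (intro arg_cong[of _ _ concat] map_cong) (auto simp: stair_row_word_eq[OF D])
  ultimately show ?thesis by (simp add: pd_word_def boxes_def)
qed

section \<open>Recovering a filling from its significant boxes\<close>

definition filling_of :: "nat \<Rightarrow> box set \<Rightarrow> filling" where
  "filling_of n S = restrict (\<lambda>b. if box_index b = 0
    then if b \<in> S then Faucet_Elbow else Single_Elbow
    else if b \<in> S then Cross else Double_Elbow) (base n)"

lemma significant_filling_of: "b \<in> base n \<Longrightarrow> significant (filling_of n S) b \<longleftrightarrow> b \<in> S"
  by (simp add: significant_def filling_of_def)

lemma filling_of_in_signed_pipe_dreams: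
  assumes "finite S"
  shows "filling_of n S \<in> signed_pipe_dreams n"
proof -
  have "finite {b \<in> base n. significant (filling_of n S) b}"
    by (rule finite_subset[OF _ assms]) (auto simp: significant_filling_of)
  then show ?thesis by (auto simp: signed_pipe_dreams_def filling_of_def allowed_def)
qed

lemma pipe_dream_apply:
  assumes "D \<in> signed_pipe_dreams n" "b \<in> base n"
  shows "D b = (if box_index b = 0
    then if significant D b then Faucet_Elbow else Single_Elbow
    else if significant D b then Cross else Double_Elbow)"
  using pipe_dream_allowed[OF assms] by (auto simp: allowed_def significant_def split: if_splits)

lemma pipe_dream_eqI:
  assumes "D \<in> signed_pipe_dreams n" "D' \<in> signed_pipe_dreams n"
    and "\<And>b. b \<in> base n \<Longrightarrow> significant D b \<longleftrightarrow> significant D' b"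
  shows "D = D'"
proof (rule PiE_ext)
  show "D \<in> Pi\<^sub>E (base n) allowed" "D' \<in> Pi\<^sub>E (base n) allowed"
    using assms(1,2) by (auto simp: signed_pipe_dreams_def)
qed (simp only: pipe_dream_apply[OF assms(1)] pipe_dream_apply[OF assms(2)] assms(3))

lemma finite_significant: "D \<in> signed_pipe_dreams n \<Longrightarrow> finite {b \<in> base n. significant D b}"
  by (simp add: signed_pipe_dreams_def)

lemma gamma_bound_exists:
  assumes "D \<in> signed_pipe_dreams n"
  shows "\<exists>K. \<forall>k>K. \<not> gamma_nonempty n D k"
proof -
  let ?f = "\<lambda>b. case b of Stair i j \<Rightarrow> 0 | Hor k i \<Rightarrow> k | Ver k i \<Rightarrow> k"
  have "finite (?f ` {b \<in> base n. significant D b})"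
    using finite_significant[OF assms] by simp
  then obtain K where K: "\<forall>x\<in>?f ` {b \<in> base n. significant D b}. x \<le> K"
    using finite_nat_set_iff_bounded_le by blast
  have "\<not> gamma_nonempty n D k" if "k > K" for k
  proof
    assume "gamma_nonempty n D k"
    then obtain b where b: "b \<in> gamma_boxes n k" "significant D b" by (auto simp: gamma_nonempty_def)
    then have "b \<in> base n" using that unfolding base_def by fastforce
    moreover have "?f b = k" using b(1) by (auto simp: gamma_boxes_def)
    ultimately show False using K b(2) that by fastforce
  qed
  then show ?thesis by blast
qed


section \<open>Admissible moves\<close>

text \<open>A box at which the preceding word has a descent cannot carry a significant element, and
  exchanging it with the letter to be deleted is an admissible move.\<close>

lemma terminal_asc:
  assumes w: "w \<in> BC n" and D: "D \<in> PD n w"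
    and K: "\<And>k. k > K \<Longrightarrow> \<not> gamma_nonempty n D k"
    and terminal: "\<And>D'. \<not> admissible_move n D D'"
    and split: "boxes n K = xs @ b # ys"
  shows "asc (word_prod (sig_word D xs)) (box_index b)"
proof (rule ccontr)
  let ?i = "box_index b"
  assume desc: "\<not> asc (word_prod (sig_word D xs)) ?i"
  have spd: "D \<in> signed_pipe_dreams n" and red: "reduced_word n w (pd_word n D)"
    using D by (auto simp: PD_def)
  have word: "pd_word n D = sig_word D xs @ sig_word D [b] @ sig_word D ys"
    using pd_word_eq[OF spd K] split sig_word_append[of D "[b]" ys] by simp
  have nb: "\<not> significant D b"
    using reduced_word_asc[of n w "sig_word D xs" ?i "sig_word D ys"] red desc
    by (auto simp: word sig_word_Cons)
  obtain xs1 a xs2 where xs: "filter (significant D) xs = xs1 @ a # xs2"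
    and del: "word_prod (map box_index (xs1 @ xs2))
      = word_prod (map box_index (filter (significant D) xs)) \<circ> gen ?i"
    and type: "box_index a = 0 \<longleftrightarrow> ?i = 0"
    and img: "?i = 0 \<or> word_prod (map box_index xs2) (int ?i)
      \<in> {int (box_index a), - int (box_index a) - 1}"
    using exchange[OF desc[unfolded sig_word_def]] by blast
  have "a \<in> set (filter (significant D) xs)" unfolding xs by simp
  then have a: "significant D a" "a \<in> set xs" by auto
  have ab: "before a b" "a \<noteq> b" and base: "a \<in> base n" "b \<in> base n"
    using sorted_boxes[of n K] set_boxes_subset[of n K] a nb by (auto simp: split sorted_wrt_append)
  \<comment> \<open>In a common row all letters between \<open>a\<close> and \<open>b\<close> have
    index above \<open>?i\<close> and so fix the point \<open>?i\<close>. The recorded image then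
    gives \<open>box_index a = ?i\<close>, although \<open>a\<close> is read earlier and has a
    larger index. For \<open>?i = 0\<close> the index of \<open>a\<close> is 0 as well.\<close>
  have "row_above a b"
  proof (rule ccontr)
    assume "\<not> row_above a b"
    then have same: "same_row a b" and less: "box_index a > ?i" using ab by (auto simp: before_def)
    have "sorted_wrt before (filter (significant D) xs)"
      using sorted_boxes[of n K] by (simp add: split sorted_wrt_append sorted_wrt_filter)
    then have "before a c" if "c \<in> set xs2" for c
      using that by (auto simp: xs sorted_wrt_append)
    moreover have "before c b" if "c \<in> set xs2" for c
    proof -
      have "c \<in> set (filter (significant D) xs)" using that by (simp add: xs)
      then show ?thesis using sorted_boxes[of n K] by (auto simp: split sorted_wrt_append)
    qed
    ultimately have "box_index c > ?i" if "c \<in> set xs2" for c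
      using before_between same that by blast
    then have "word_prod (map box_index xs2) (int ?i) = int ?i" if "?i \<ge> 1"
      using that by (intro word_prod_fixes) force+
    then show False using img type less by (cases "?i = 0") auto
  qed
  let ?S = "insert b ({c \<in> base n. significant D c} - {a})"
  let ?D = "filling_of n ?S"
  have spd': "?D \<in> signed_pipe_dreams n"
    using finite_significant[OF spd] by (intro filling_of_in_signed_pipe_dreams) simp
  have sig: "significant ?D c \<longleftrightarrow> c = b \<or> significant D c \<and> c \<noteq> a" if "c \<in> base n" for c
    using that by (auto simp: significant_filling_of)
  have dist: "distinct (xs @ b # ys)" using distinct_boxes[of n K] by (simp add: split)
  have sub: "set (xs @ b # ys) \<subseteq> base n" using set_boxes_subset[of n K] by (simp add: split)
  have K': "\<not> gamma_nonempty n ?D k" if "k > K" for k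
  proof
    assume "gamma_nonempty n ?D k"
    then obtain c where c: "c \<in> gamma_boxes n k" "significant ?D c" by (auto simp: gamma_nonempty_def)
    have cb: "c \<in> base n" using c(1) that unfolding base_def by fastforce
    have "b \<in> set (boxes n K)" by (simp add: split)
    then have "c \<noteq> b" using c(1) that by (auto simp: set_boxes gamma_boxes_def stair_boxes_def)
    then show False using sig[OF cb] c K[OF that] by (auto simp: gamma_nonempty_def)
  qed
  have d: "distinct (xs1 @ a # xs2)" using dist by (simp flip: xs)
  have "filter (significant ?D) xs = filter (\<lambda>c. c \<noteq> a) (filter (significant D) xs)"
    unfolding filter_filter using sub dist sig by (intro filter_cong) auto
  also have "\<dots> = xs1 @ xs2"
  proof -
    have "filter (\<lambda>c. c \<noteq> a) xs1 = xs1" "filter (\<lambda>c. c \<noteq> a) xs2 = xs2"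
      using d by (auto intro!: filter_True)
    then show ?thesis by (simp add: xs)
  qed
  finally have 1: "sig_word ?D xs = map box_index (xs1 @ xs2)" by (simp add: sig_word_def)
  have 2: "sig_word ?D ys = sig_word D ys"
    unfolding sig_word_def using sub dist sig a(2)
    by (intro arg_cong[of _ _ "map box_index"] filter_cong) auto
  have word': "pd_word n ?D = map box_index (xs1 @ xs2) @ ?i # sig_word D ys"
    using pd_word_eq[OF spd' K'] sig[OF base(2)] by (simp add: split 1 2 sig_word_Cons)
  have len: "length (pd_word n ?D) = length (pd_word n D)"
    using nb by (simp add: word word' sig_word_def xs)
  \<comment> \<open>Removing \<open>a\<close> multiplies the product before \<open>b\<close> by
    \<open>gen ?i\<close>, and the new letter at \<open>b\<close> cancels this factor.\<close>
  have "word_prod (pd_word n ?D) = word_prod (map box_index (xs1 @ xs2)) \<circ> gen ?i \<circ> word_prod (sig_word D ys)"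
    unfolding word' word_prod_append word_prod_Cons by (simp only: comp_assoc)
  also have "\<dots> = word_prod (sig_word D xs) \<circ> (gen ?i \<circ> gen ?i) \<circ> word_prod (sig_word D ys)"
    unfolding del sig_word_def by (simp only: comp_assoc)
  also have "\<dots> = word_prod (pd_word n D)"
    using nb by (simp add: word sig_word_Cons)
  finally have prod: "word_prod (pd_word n ?D) = word_prod (pd_word n D)" .
  have "set (pd_word n ?D) \<subseteq> {..<n}"
    using set_sig_word[OF set_boxes_subset] pd_word_eq[OF spd' K'] by simp
  then have "reduced_word n w (pd_word n ?D)"
    using red len prod by (simp add: reduced_word_def word_for_def)
  then have "?D \<in> PD n w" using spd' by (simp add: PD_def)
  moreover have "?D c = D c" if "c \<in> base n" "c \<noteq> a" "c \<noteq> b" for c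
    using pipe_dream_apply[OF spd that(1)] pipe_dream_apply[OF spd' that(1)] sig[OF that(1)] that(2,3)
    by simp
  ultimately have "admissible_move n D ?D"
    unfolding admissible_move_def
    using w D base \<open>row_above a b\<close> type nb a ab(2) sig[OF base(1)] sig[OF base(2)]
      pipe_dream_apply[OF spd base(1)] pipe_dream_apply[OF spd base(2)]
      pipe_dream_apply[OF spd' base(1)] pipe_dream_apply[OF spd' base(2)]
    by (intro conjI bexI[of _ w] bexI[of _ a] bexI[of _ b]) auto
  then show False using terminal by blast
qed

text \<open>A Gamma-block consists of one horizontal row and \<open>n\<close> vertical ones, so
  consecutive blocks are \<open>Suc n\<close> apart; as block numbers start at 1, the staircase rows
  remain below all of them.\<close>

fun height :: "nat \<Rightarrow> box \<Rightarrow> nat" where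
  "height n (Stair i j) = n - i"
| "height n (Hor k i) = k * Suc n + n"
| "height n (Ver k i) = k * Suc n + (n - 1 - i)"

lemma height_less:
  assumes "a \<in> base n" "b \<in> base n" "row_above a b"
  shows "height n b < height n a"
proof -
  have *: "k' * Suc n + n < k * Suc n" if "k' < k" for k k'
  proof -
    have "Suc k' * Suc n \<le> k * Suc n" using that by (intro mult_right_mono) auto
    then show ?thesis by simp
  qed
  show ?thesis
    using assms
    apply (cases a; cases b)
            apply (auto simp: base_def stair_boxes_def gamma_boxes_def simp del: mult_Suc_right)
    subgoal for k k' i i' using mult_le_mono1[of k' k "Suc n"] by simp
    subgoal for r c k i using *[of 0 k] by simp
    subgoal for k k' i i' using *[of k' k] by simp
    subgoal for k k' i i' using *[of k' k] by simp
    done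
qed

definition weight :: "nat \<Rightarrow> filling \<Rightarrow> nat" where
  "weight n D = (\<Sum>b | b \<in> base n \<and> significant D b. height n b)"

lemma weight_less:
  assumes "admissible_move n D' D"
  shows "weight n D < weight n D'"
proof -
  obtain a b where ab: "a \<in> base n" "b \<in> base n" "row_above a b"
    and same: "\<And>c. c \<in> base n \<Longrightarrow> c \<noteq> a \<Longrightarrow> c \<noteq> b \<Longrightarrow> D c = D' c"
    and "D' a = Cross \<and> D a = Double_Elbow \<and> D' b = Double_Elbow \<and> D b = Cross \<or>
      D' a = Faucet_Elbow \<and> D a = Single_Elbow \<and> D' b = Single_Elbow \<and> D b = Faucet_Elbow"
    using assms unfolding admissible_move_def by blast
  then have sig: "significant D' a" "\<not> significant D a" "\<not> significant D' b" "significant D b"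
    by (auto simp: significant_def)
  have fin: "finite {b \<in> base n. significant D' b}"
    using assms by (auto simp: admissible_move_def PD_def finite_significant)
  let ?T = "{b \<in> base n. significant D' b} - {a}"
  have "{b \<in> base n. significant D b} = insert b ?T"
  proof (rule set_eqI)
    fix c
    have "c \<noteq> a \<Longrightarrow> c \<noteq> b \<Longrightarrow> c \<in> base n \<Longrightarrow> significant D c \<longleftrightarrow> significant D' c"
      using same by (simp add: significant_def)
    then show "c \<in> {b \<in> base n. significant D b} \<longleftrightarrow> c \<in> insert b ?T"
      using ab sig by (cases "c = a"; cases "c = b") auto
  qed
  then have "weight n D = height n b + (\<Sum>c\<in>?T. height n c)"
    using fin sig by (simp add: weight_def)
  moreover have "weight n D' = height n a + (\<Sum>c\<in>?T. height n c)"
    unfolding weight_def using fin sig ab(1) by (intro sum.remove) auto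
  ultimately show ?thesis using height_less[OF ab] by simp
qed


section \<open>Ascents along a row\<close>

lemma asc_Suc: "i \<ge> 1 \<Longrightarrow> asc u i \<longleftrightarrow> u (int i) < u (int (Suc i))"
  by (simp add: asc_pos add.commute)

lemma gen_at:
  assumes "i \<ge> 1"
  shows "gen i (int i) = int (Suc i)" "gen i (int (Suc i)) = int i"
  using assms by (auto simp: gen_pos)

text \<open>With \<open>u\<close> the product of everything read before the row and \<open>X\<close>
  marking its significant boxes, this is the product after the indices \<open>n - 1\<close> down to
  \<open>a\<close>. The box of index \<open>p\<close> sees
  \<open>row_state u X (Suc p) n\<close>.\<close>

definition row_state :: "(int \<Rightarrow> int) \<Rightarrow> (nat \<Rightarrow> bool) \<Rightarrow> nat \<Rightarrow> nat \<Rightarrow> int \<Rightarrow> int" where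
  "row_state u X a n = u \<circ> word_prod (filter X (rev [a..<n]))"

lemma row_state_ge: "n \<le> a \<Longrightarrow> row_state u X a n = u"
  by (simp add: row_state_def)

lemma row_state_step:
  assumes "a < n"
  shows "row_state u X a n
    = (if X a then row_state u X (Suc a) n \<circ> gen a else row_state u X (Suc a) n)"
  unfolding row_state_def upt_conv_Cons[OF assms] rev.simps filter_append word_prod_append
  by (simp add: comp_assoc)

lemma row_state_below: "1 \<le> p \<Longrightarrow> p < a \<Longrightarrow> row_state u X a n (int p) = u (int p)"
  unfolding row_state_def comp_apply by (subst word_prod_fixes) auto

lemma row_state_above:
  assumes "lo \<le> a" "a < p" "a \<le> n"
  shows "row_state u X lo n (int p) = row_state u X a n (int p)"
proof -
  have "[lo..<n] = [lo..<a] @ [a..<n]"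
    using assms upt_add_eq_append[of lo a "n - a"] by simp
  moreover have "word_prod (filter X (rev [lo..<a])) (int p) = int p"
    using assms by (intro word_prod_fixes) auto
  ultimately show ?thesis by (simp add: row_state_def)
qed

lemma row_state_at:
  assumes "1 \<le> q" "q < n"
  shows "row_state u X (Suc q) n (int q) = u (int q)"
  using row_state_below[of q "Suc q" u X n] assms by simp

text \<open>Letters below \<open>q\<close> do not move the point \<open>Suc q\<close>, so its value
  is settled once index \<open>q\<close> is read. A cross there brings in \<open>u q\<close>,
  untouched so far because all earlier letters of the row exceed \<open>q\<close>.\<close>

lemma row_state_final:
  assumes "lo \<le> q" "1 \<le> q" "q < n"
  shows "row_state u X lo n (int (Suc q)) = (if X q then u (int q) else row_state u X (Suc q) n (int (Suc q)))"
  using row_state_above[of lo q "Suc q" n u X] row_state_step[of q n u X] row_state_at[of q n u X] assms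
  by (simp add: gen_at del: of_nat_Suc)

text \<open>Let \<open>c\<close> be the value at \<open>Suc q\<close> when index \<open>q\<close> is
  reached. The ascent gives \<open>u q < c\<close>, while \<open>u (Suc q) \<le> u q\<close>, so
  \<open>c\<close> differs from \<open>u (Suc q)\<close>. Hence index \<open>Suc q\<close> exists
  and carries a cross, which sends \<open>u (Suc q)\<close> to the next position; what finally
  stands before it is \<open>c\<close> or \<open>u q\<close>, neither of them smaller.\<close>

lemma row_descent_shift:
  assumes lo: "1 \<le> lo" "lo \<le> q" "q < n" and desc: "\<not> asc u q"
    and asc: "\<And>p. lo \<le> p \<Longrightarrow> p < n \<Longrightarrow> asc (row_state u X (Suc p) n) p"
  shows "Suc q < n \<and> \<not> asc (row_state u X lo n) (Suc q)"
proof -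
  let ?s = "\<lambda>a p. row_state u X a n (int p)"
  have d: "u (int (Suc q)) \<le> u (int q)" using desc lo by (simp add: asc_Suc del: of_nat_Suc)
  have 1: "u (int q) < ?s (Suc q) (Suc q)"
    using asc[of q] lo row_state_at[of q n u X] by (simp add: asc_Suc del: of_nat_Suc)
  have less: "Suc q < n"
  proof (rule ccontr)
    assume "\<not> Suc q < n"
    then show False using 1 d by (simp add: row_state_ge del: of_nat_Suc)
  qed
  have 2: "?s (Suc (Suc q)) (Suc q) = u (int (Suc q))"
    using row_state_at[of "Suc q" n u X] less by simp
  have X: "X (Suc q)"
  proof (rule ccontr)
    assume "\<not> X (Suc q)"
    then show False using row_state_step[OF less, of u X] 1 2 d by (simp del: of_nat_Suc)
  qed
  have "?s lo (Suc (Suc q)) = u (int (Suc q))"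
    using row_state_final[of lo "Suc q" n u X] X less lo by (simp del: of_nat_Suc)
  moreover have "u (int (Suc q)) \<le> ?s lo (Suc q)"
    using row_state_final[of lo q n u X] 1 d lo by (auto simp del: of_nat_Suc)
  ultimately show ?thesis using less by (simp add: asc_Suc del: of_nat_Suc)
qed

text \<open>The cross at \<open>Suc p\<close> puts the larger of two ascending values in front, and
  without a cross at \<open>p\<close> nothing in the rest of the row moves it away.\<close>

lemma row_gap_descent:
  assumes lo: "1 \<le> lo" "lo \<le> p" "Suc p < n" and X: "X (Suc p)" "\<not> X p"
    and asc: "asc (row_state u X (Suc (Suc p)) n) (Suc p)"
  shows "\<not> asc (row_state u X lo n) (Suc p)"
proof -
  let ?s = "\<lambda>a p. row_state u X a n (int p)"
  have a: "u (int (Suc p)) < ?s (Suc (Suc p)) (Suc (Suc p))"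
    using asc row_state_at[of "Suc p" n u X] lo by (simp add: asc_Suc del: of_nat_Suc)
  have "?s lo (Suc p) = ?s (Suc (Suc p)) (Suc (Suc p))"
    using row_state_final[of lo p n u X] row_state_step[of "Suc p" n u X] X lo
    by (simp add: gen_at del: of_nat_Suc)
  moreover have "?s lo (Suc (Suc p)) = u (int (Suc p))"
    using row_state_final[of lo "Suc p" n u X] X lo by (simp del: of_nat_Suc)
  ultimately show ?thesis using a by (simp add: asc_Suc del: of_nat_Suc)
qed

lemma BC_row_state: "u \<in> BC n \<Longrightarrow> row_state u X a n \<in> BC n"
  unfolding row_state_def by (intro BC_comp word_prod_in_BC) auto

text \<open>The cross of largest index turns the ascent that it sees into a descent, and no later
  vertical letter can repair it.\<close>

lemma vertical_no_cross:
  assumes ver: "\<And>i. i < n \<Longrightarrow> asc (F \<circ> word_prod (filter Y [0..<i])) i"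
    and fin: "\<And>q. 1 \<le> q \<Longrightarrow> q < n \<Longrightarrow> asc (F \<circ> word_prod (filter Y [0..<n])) q"
    and i: "1 \<le> i" "i < n"
  shows "\<not> Y i"
proof
  assume "Y i"
  let ?A = "{i. 1 \<le> i \<and> i < n \<and> Y i}"
  define m where "m = Max ?A"
  have "finite ?A" by simp
  moreover have "?A \<noteq> {}" using i \<open>Y i\<close> by auto
  ultimately have "m \<in> ?A" unfolding m_def by (rule Max_in)
  have max: "j \<le> m" if "j \<in> ?A" for j
    unfolding m_def using \<open>finite ?A\<close> that by (rule Max_ge)
  have m: "1 \<le> m" "m < n" "Y m" using \<open>m \<in> ?A\<close> by auto
  have "[0..<n] = [0..<m] @ m # [Suc m..<n]"
    using m upt_add_eq_append[of 0 m "n - m"] by (simp add: upt_conv_Cons)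
  moreover have "filter Y [Suc m..<n] = []"
  proof -
    have "\<not> Y j" if "j \<in> set [Suc m..<n]" for j
      using max[of j] that m by auto
    then show ?thesis by (simp add: filter_empty_conv)
  qed
  ultimately have "filter Y [0..<n] = filter Y [0..<m] @ [m]" using m by simp
  then have "\<not> asc (F \<circ> word_prod (filter Y [0..<n])) m"
    using ver[of m] m by (simp add: asc_Suc gen_at del: of_nat_Suc)
  then show False using fin m by blast
qed

text \<open>Here \<open>u\<close> is the product of the blocks above and \<open>F\<close> the
  product up to the vertical part. The hypothesis \<open>fin\<close> comes from what is read below
  the block, and the last conclusion is the same statement for the block above.\<close>

lemma gamma_block_shape:
  fixes u X Y n
  defines "F \<equiv> row_state u X 0 n"
  assumes u: "u \<in> BC n" and n: "1 \<le> n"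
    and hor: "\<And>p. p < n \<Longrightarrow> asc (row_state u X (Suc p) n) p"
    and ver: "\<And>i. i < n \<Longrightarrow> asc (F \<circ> word_prod (filter Y [0..<i])) i"
    and fin: "\<And>q. 1 \<le> q \<Longrightarrow> q < n \<Longrightarrow> asc (F \<circ> word_prod (filter Y [0..<n])) q"
  shows "\<And>i. 1 \<le> i \<Longrightarrow> i < n \<Longrightarrow> \<not> Y i"
    and "\<not> Y 0 \<Longrightarrow> F = id"
    and "Y 0 \<Longrightarrow> \<not> X 0"
    and "\<And>p. Y 0 \<Longrightarrow> 1 \<le> p \<Longrightarrow> Suc p < n \<Longrightarrow> X (Suc p) \<Longrightarrow> X p"
    and "\<And>q. Y 0 \<Longrightarrow> 1 \<le> q \<Longrightarrow> q < n \<Longrightarrow> asc u q"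
proof -
  show noY: "\<not> Y i" if "1 \<le> i" "i < n" for i
    using vertical_no_cross[of n F Y i] ver fin that by blast
  have F: "F \<in> BC n" unfolding F_def using u by (rule BC_row_state)
  have F1: "F 1 > 0" using ver[of 0] n BC_minus[OF F] by (simp add: asc_0)
  have "filter Y [0..<n] = (if Y 0 then [0] else [])"
    using n noY by (auto simp: upt_conv_Cons filter_empty_conv)
  then have fin': "asc (if Y 0 then F \<circ> gen 0 else F) q" if "1 \<le> q" "q < n" for q
    using fin[OF that] by (auto split: if_splits)
  show "F = id" if "\<not> Y 0"
  proof (rule BC_eq_id_if_asc[OF F])
    fix i assume "i < n"
    then show "asc F i" using fin' that F1 BC_minus[OF F] by (cases "i = 0") (auto simp: asc_0)
  qed
  \<comment> \<open>\<open>gen 0\<close> changes only the values at 1 and -1, so the ascents behind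
    the block are ascents of \<open>F\<close> from index 2 on. Gaps and shifted descents show up at
    an index \<open>Suc p\<close> or \<open>Suc q\<close> with positive \<open>p\<close> or
    \<open>q\<close>, hence in this range.\<close>
  have F2: "asc F q" if "Y 0" "2 \<le> q" "q < n" for q
    using fin'[of q] that by (auto simp: asc_Suc gen_0)
  show noX: "\<not> X 0" if "Y 0"
  proof
    assume "X 0"
    let ?s = "row_state u X (Suc 0) n"
    have s: "?s \<in> BC n" using u by (rule BC_row_state)
    have "?s 1 > 0" using hor[of 0] n BC_minus[OF s] by (simp add: asc_0)
    moreover have "F 1 = ?s (- 1)" using row_state_step[of 0 n u X] n \<open>X 0\<close> by (simp add: F_def gen_0)
    ultimately show False using F1 BC_minus[OF s, of 1] by simp
  qed
  have F': "F = row_state u X 1 n" if "Y 0"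
    using row_state_step[of 0 n u X] n noX[OF that] by (simp add: F_def)
  show "X p" if "Y 0" "1 \<le> p" "Suc p < n" "X (Suc p)" for p
  proof (rule ccontr)
    assume "\<not> X p"
    then have "\<not> asc F (Suc p)"
      using row_gap_descent[of 1 p n X u] hor[of "Suc p"] that F' by simp
    then show False using F2 that by simp
  qed
  show "asc u q" if "Y 0" "1 \<le> q" "q < n" for q
  proof (rule ccontr)
    assume "\<not> asc u q"
    then show False using row_descent_shift[of 1 q n u X] hor F2[of "Suc q"] F' that by auto
  qed
qed


section \<open>Products of left-adjusted rows\<close>

lemma word_prod_rev_upt:
  assumes "1 \<le> a" "a \<le> b" "1 \<le> p"
  shows "word_prod (rev [a..<b]) (int p)
    = (if p = a then int b else if a < p \<and> p \<le> b then int p - 1 else int p)"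
  using assms(2)
proof (induction b rule: dec_induct)
  case base
  then show ?case by simp
next
  case (step b)
  then show ?case using assms by (auto simp: gen_pos)
qed

text \<open>\<open>rev [0..<c]\<close> is the word of a bottom block with \<open>c\<close>
  significant elements: horizontal crosses, then the faucet. The faucet is read last and acts first,
  so 1 becomes -1 and the crosses carry it on.\<close>

lemma word_prod_rev_upt_0:
  assumes "1 \<le> c" "1 \<le> p"
  shows "word_prod (rev [0..<c]) (int p)
    = (if p = 1 then - int c else if p \<le> c then int p - 1 else int p)"
proof -
  have w: "word_prod (rev [0..<c]) x = word_prod (rev [1..<c]) (gen 0 x)" for x
    using assms by (simp add: upt_conv_Cons)
  have "word_prod (rev [1..<c]) 1 = int c"
    using word_prod_rev_upt[of 1 c 1] assms by simp
  moreover have "word_prod (rev [1..<c]) (- 1) = - word_prod (rev [1..<c]) 1"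
    by (rule word_prod_minus)
  ultimately show ?thesis
    using word_prod_rev_upt[of 1 c p] assms by (auto simp: w gen_0)
qed

text \<open>For the product of the blocks from some block upwards, \<open>c\<close> is the number of
  significant elements of the lowest of these blocks.\<close>

definition block_state :: "(int \<Rightarrow> int) \<Rightarrow> nat \<Rightarrow> bool" where
  "block_state u c \<longleftrightarrow> (\<forall>x>int c. u x = x) \<and> (c \<ge> 1 \<longrightarrow> u 1 = - int c)"

text \<open>Since \<open>c' < c\<close>, the map \<open>u\<close> still fixes \<open>c\<close>, so
  the image -c of 1 under the new block is kept by \<open>u\<close>.\<close>

lemma block_state_step:
  assumes "block_state u c'" "c' < c" "\<And>x. u (- x) = - u x"
  shows "block_state (u \<circ> word_prod (rev [0..<c])) c"
proof -
  have "(u \<circ> word_prod (rev [0..<c])) x = x" if "x > int c" for x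
    using word_prod_rev_upt_0[of c "nat x"] that assms by (auto simp: block_state_def)
  moreover have "word_prod (rev [0..<c]) 1 = - int c"
    using word_prod_rev_upt_0[of c 1] assms by simp
  ultimately show ?thesis using assms by (auto simp: block_state_def)
qed

text \<open>For \<open>c \<ge> 2\<close> the ascent at 1 reads \<open>- u c < u 1 = - c'\<close>. So
  \<open>u c\<close> exceeds \<open>c'\<close> and is fixed by \<open>u\<close>, and injectivity
  gives \<open>u c = c\<close>. The case \<open>c = 1\<close> is excluded because \<open>u 1\<close>
  is negative.\<close>

lemma count_less:
  assumes st: "block_state u c'" and c: "1 \<le> c" "c \<le> n" and inj: "inj u"
    and odd: "\<And>x. u (- x) = - u x" and pos: "u (int c) > 0"
    and asc: "2 \<le> n \<Longrightarrow> asc (u \<circ> word_prod (rev [0..<c])) 1"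
  shows "c' < c"
proof (cases "c' = 0")
  case False
  then have u1: "u 1 = - int c'" and id_above: "\<And>x. x > int c' \<Longrightarrow> u x = x"
    using st by (auto simp: block_state_def)
  have "c \<noteq> 1" using pos u1 by auto
  then have "2 \<le> c" using c by simp
  have "word_prod (rev [0..<c]) 1 = - int c" "word_prod (rev [0..<c]) 2 = 1"
    using word_prod_rev_upt_0[of c 1] word_prod_rev_upt_0[of c 2] \<open>2 \<le> c\<close> by simp_all
  then have "- u (int c) < - int c'"
    using asc c \<open>2 \<le> c\<close> u1 odd by (simp add: asc_pos)
  then have "u (u (int c)) = u (int c)" using id_above by simp
  then have "u (int c) = int c" using inj by (auto dest: injD)
  then show ?thesis using \<open>- u (int c) < - int c'\<close> by simp
qed (use c in simp)

text \<open>The new values at 1, 2, ... are -c followed by the old ascending sequence with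
  \<open>u c = c\<close> left out, so only \<open>- c < u 1\<close> needs an argument.\<close>

lemma block_state_asc:
  assumes st: "block_state u c'" and c: "c' < c" "c \<le> n" and inj: "inj u"
    and odd: "\<And>x. u (- x) = - u x" and asc: "\<And>q. 1 \<le> q \<Longrightarrow> q < n \<Longrightarrow> asc u q"
    and q: "1 \<le> q" "q < n"
  shows "asc (u \<circ> word_prod (rev [0..<c])) q"
proof -
  have id_above: "\<And>x. x > int c' \<Longrightarrow> u x = x" using st by (auto simp: block_state_def)
  have v1: "word_prod (rev [0..<c]) (int p)
    = (if p = 1 then - int c else if p \<le> c then int p - 1 else int p)" if "1 \<le> p" for p
    using word_prod_rev_upt_0[of c p] that c by simp
  have "asc u q" using asc q by blast
  then have aq: "u (int q) < u (int q + 1)" using q by (simp add: asc_pos)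
  consider "q = 1" "c = 1" | "q = 1" "c > 1" | "q > 1" "q < c" | "q > 1" "q = c" | "q > 1" "q > c"
    using q c by (cases "q = 1"; cases "c = 1"; cases q c rule: linorder_cases) auto
  then show ?thesis
  proof cases
    case 1
    then show ?thesis using v1[of 1] v1[of 2] id_above[of 1] id_above[of 2] c odd by (simp add: asc_pos)
  next
    case 2
    \<comment> \<open>Otherwise \<open>- u 1\<close> exceeds \<open>c'\<close> and is fixed by
      \<open>u\<close>; by oddness so is \<open>u 1\<close>, and injectivity gives
      \<open>u 1 = 1\<close>.\<close>
    have "- int c < u 1"
    proof (rule ccontr)
      assume "\<not> - int c < u 1"
      then have "u (- u 1) = - u 1" using id_above[of "- u 1"] c by simp
      then have "- u 1 = 1" "- u 1 \<noteq> 1"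
        using odd[of "u 1"] inj c \<open>\<not> - int c < u 1\<close> \<open>c > 1\<close> by (auto dest!: injD)
      then show False by simp
    qed
    then show ?thesis using v1[of 1] v1[of 2] id_above[of "int c"] c odd 2 by (simp add: asc_pos)
  next
    case 3
    have "asc u (q - 1)" using asc[of "q - 1"] 3 q by simp
    then show ?thesis using v1[of q] v1[of "Suc q"] 3 by (simp add: asc_Suc of_nat_diff add.commute)
  next
    case 4
    have "asc u (q - 1)" using asc[of "q - 1"] 4 q by simp
    then show ?thesis using v1[of q] v1[of "Suc q"] 4 aq by (simp add: asc_Suc of_nat_diff add.commute)
  next
    case 5
    then show ?thesis using v1[of q] v1[of "Suc q"] aq by (simp add: asc_Suc add.commute)
  qed
qed

text \<open>This is the set enumerated by \<open>code_N\<close>, phrased without the inverse and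
  without the bound \<open>n\<close> so that it can be followed from block to block.\<close>

definition neg_values :: "(int \<Rightarrow> int) \<Rightarrow> nat set" where
  "neg_values u = {m. 1 \<le> m \<and> (\<exists>x<0. u x = int m)}"

text \<open>Negative arguments are only shifted among themselves, except that -1 now yields
  \<open>c\<close>. The argument -c dropped by the shift loses nothing, its image under
  \<open>u\<close> being the negative number -c.\<close>

lemma neg_values_step:
  assumes st: "block_state u c'" and c: "c' < c" and odd: "\<And>x. u (- x) = - u x"
  shows "neg_values (u \<circ> word_prod (rev [0..<c])) = insert c (neg_values u)"
proof -
  let ?v = "u \<circ> word_prod (rev [0..<c])"
  have id_above: "\<And>x. x > int c' \<Longrightarrow> u x = x" using st by (auto simp: block_state_def)
  have v: "?v (- int p) = (if p = 1 then int c else if p \<le> c then u (- (int p - 1)) else u (- int p))"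
    if "1 \<le> p" for p
    using word_prod_rev_upt_0[of c p] that c id_above[of "int c"] word_prod_minus[of "rev [0..<c]" "int p"] odd[of "int p - 1"] odd[of "int c"]
    by auto
  have neg: "\<exists>p\<ge>1. x = - int p" if "x < 0" for x :: int
    using that by (intro exI[of _ "nat (- x)"]) auto
  show ?thesis
  proof (intro equalityI subsetI)
    fix m assume "m \<in> neg_values ?v"
    then obtain x where "x < 0" "?v x = int m" and m: "1 \<le> m" by (auto simp: neg_values_def)
    then obtain p where p: "1 \<le> p" "?v (- int p) = int m" using neg by blast
    consider "p = 1" | "2 \<le> p" "p \<le> c" | "c < p" using p(1) by linarith
    then show "m \<in> insert c (neg_values u)"
    proof cases
      case 2
      then have "u (- (int p - 1)) = int m" "- (int p - 1) < 0" using p v[of p] by auto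
      then show ?thesis using m unfolding neg_values_def by blast
    next
      case 3
      then have "u (- int p) = int m" "- int p < 0" using p v[of p] c by auto
      then show ?thesis using m unfolding neg_values_def by blast
    qed (use v[of p] p in auto)
  next
    fix m assume "m \<in> insert c (neg_values u)"
    then consider "m = c" | "m \<in> neg_values u" by blast
    then show "m \<in> neg_values ?v"
    proof cases
      case 1
      then have "?v (- int 1) = int m" using v[of 1] by simp
      then show ?thesis using 1 c unfolding neg_values_def by (auto intro!: exI[of _ "- 1"])
    next
      case 2
      then obtain x where "x < 0" "u x = int m" and m: "1 \<le> m" by (auto simp: neg_values_def)
      then obtain p where p: "1 \<le> p" "u (- int p) = int m" using neg by blast
      have "p \<le> c'"
        using id_above[of "int p"] p m odd[of "int p"] by (cases "p \<le> c'") auto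
      then have "?v (- int (Suc p)) = int m" using v[of "Suc p"] p c by simp
      then show ?thesis using m unfolding neg_values_def by (auto intro!: exI[of _ "- int (Suc p)"])
    qed
  qed
qed


section \<open>The shape of bottom pipe dreams\<close>

lemma filter_upt_down_closed:
  assumes "lo \<le> n" "\<And>p. lo \<le> p \<Longrightarrow> Suc p < n \<Longrightarrow> X (Suc p) \<Longrightarrow> X p"
  shows "\<exists>c. lo + c \<le> n \<and> filter X [lo..<n] = [lo..<lo + c]"
  using assms
proof (induction n rule: dec_induct)
  case base
  then show ?case by (auto intro: exI[of _ 0])
next
  case (step n)
  obtain c where c: "lo + c \<le> n" "filter X [lo..<n] = [lo..<lo + c]"
    using step.IH step.prems by (metis less_Suc_eq)
  show ?case
  proof (cases "X n")
    case True
    have "X p" if "p \<le> n" "lo \<le> p" for p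
      using that by (induction p rule: inc_induct) (use True step.prems in auto)
    then have "filter X [lo..<Suc n] = [lo..<lo + (Suc n - lo)]"
      using step.hyps by (auto intro!: filter_True)
    then show ?thesis using step.hyps by (intro exI[of _ "Suc n - lo"]) auto
  next
    case False
    then show ?thesis using c step.hyps by (intro exI[of _ c]) auto
  qed
qed

lemma sig_word_gamma_list:
  "sig_word D (gamma_list n k)
    = filter (\<lambda>p. significant D (Hor k p)) (rev [0..<n]) @ filter (\<lambda>p. significant D (Ver k p)) [0..<n]"
  unfolding gamma_list_def sig_word_append by (simp add: sig_word_map)

lemma sig_word_stair_list:
  "1 \<le> i \<Longrightarrow> sig_word D (stair_list n i)
    = filter (\<lambda>p. significant D (Stair i (Suc p - i))) (rev [i..<n])"
  unfolding stair_list_def by (rule sig_word_map) auto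

lemma length_sig_word: "distinct xs \<Longrightarrow> length (sig_word D xs) = card {b \<in> set xs. significant D b}"
  unfolding sig_word_def length_map by (metis distinct_card distinct_filter set_filter)

lemma gamma_count_eq: "gamma_count n D k = length (sig_word D (gamma_list n k))"
proof -
  have "distinct (gamma_list n k)" by (auto simp: gamma_list_def distinct_map inj_on_def)
  then show ?thesis by (simp add: gamma_count_def length_sig_word set_gamma_list)
qed

lemma gamma_count_zero:
  assumes "\<not> gamma_nonempty n D k"
  shows "gamma_count n D k = 0"
proof -
  have "{b \<in> gamma_boxes n k. significant D b} = {}"
    using assms by (auto simp: gamma_nonempty_def)
  then show ?thesis by (simp only: gamma_count_def card.empty)
qed

lemma stair_row_count_eq:
  assumes "D \<in> signed_pipe_dreams n" "1 \<le> i" "i < n"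
  shows "stair_row_count n D i = length (sig_word D (stair_list n i))"
proof -
  have "distinct (stair_list n i)" by (auto simp: stair_list_def distinct_map inj_on_def)
  then have "length (sig_word D (stair_list n i)) = card {b \<in> set (stair_list n i). significant D b}"
    by (rule length_sig_word)
  also have "{b \<in> set (stair_list n i). significant D b}
    = Stair i ` {j. Stair i j \<in> stair_boxes n \<and> D (Stair i j) = Cross}"
  proof -
    have "significant D (Stair i j) \<longleftrightarrow> D (Stair i j) = Cross" if "Stair i j \<in> stair_boxes n" for j
      using pipe_dream_allowed[OF assms(1), of "Stair i j"] that
      by (auto simp: base_def significant_def allowed_def stair_boxes_def)
    moreover have "Stair i j \<in> stair_boxes n \<longleftrightarrow> 1 \<le> j \<and> j \<le> n - i" for j
      using assms(2,3) by (auto simp: stair_boxes_def)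
    ultimately show ?thesis using assms(2,3) by (auto simp: set_stair_list)
  qed
  also have "card \<dots> = stair_row_count n D i"
    unfolding stair_row_count_def by (rule card_image) (simp add: inj_on_def)
  finally show ?thesis ..
qed

lemma gamma_boxes_base: "1 \<le> k \<Longrightarrow> p < n \<Longrightarrow> Hor k p \<in> base n \<and> Ver k p \<in> base n"
  by (auto simp: base_def gamma_boxes_def)

text \<open>A nonempty block has a vertical faucet, necessarily at index 0, and left-adjusted
  horizontal crosses from index 1 on. The count is therefore the only freedom left in a
  block.\<close>

lemma gamma_block_bottom:
  assumes D: "D \<in> signed_pipe_dreams n" and n: "1 \<le> n" and k: "1 \<le> k"
    and fv: "gamma_faucets_vertical n D" and ch: "gamma_crosses_horizontal n D"
  shows "sig_word D (gamma_list n k) = rev [0..<gamma_count n D k]"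
    and "gamma_count n D k \<le> n"
    and "\<And>p. p < n \<Longrightarrow> significant D (Hor k p) \<longleftrightarrow> 1 \<le> p \<and> p < gamma_count n D k"
    and "\<And>p. p < n \<Longrightarrow> significant D (Ver k p) \<longleftrightarrow> p = 0 \<and> 0 < gamma_count n D k"
proof -
  let ?X = "\<lambda>p. significant D (Hor k p)" and ?Y = "\<lambda>p. significant D (Ver k p)"
  have base: "Hor k p \<in> base n" "Ver k p \<in> base n" if "p < n" for p
    using gamma_boxes_base[OF k that] by auto
  have X0: "\<not> ?X 0" using ch k by (auto simp: gamma_crosses_horizontal_def significant_def)
  have Y: "\<not> ?Y p" if "1 \<le> p" "p < n" for p
    using ch k that pipe_dream_apply[OF D base(2)[of p]]
    by (auto simp: gamma_crosses_horizontal_def split: if_splits)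
  have "?X p" if "1 \<le> p" "Suc p < n" "?X (Suc p)" for p
  proof -
    have "D (Hor k (Suc p)) = Cross" using that pipe_dream_apply[OF D base(1)[of "Suc p"]] by simp
    then have "D (Hor k p) = Cross"
      using ch k that unfolding gamma_crosses_horizontal_def by (metis lessI)
    then show ?thesis by (simp add: significant_def)
  qed
  then obtain c where c: "1 + c \<le> n" "filter ?X [1..<n] = [1..<1 + c]"
    using filter_upt_down_closed[of 1 n ?X] n by blast
  have Xp: "?X p \<longleftrightarrow> 1 \<le> p \<and> p < 1 + c" if "p < n" for p
  proof (cases "p = 0")
    case False
    have "?X p \<longleftrightarrow> p \<in> set (filter ?X [1..<n])" using that False by auto
    then show ?thesis unfolding c(2) by auto
  qed (use X0 in simp)
  have fX: "filter ?X (rev [0..<n]) = rev [1..<1 + c]"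
    using c(2) X0 n by (simp add: upt_conv_Cons[of 0] rev_filter[symmetric] del: upt_Suc)
  have fY: "filter ?Y [0..<n] = (if ?Y 0 then [0] else [])"
    using n Y by (auto simp: upt_conv_Cons filter_empty_conv)
  have ne: "?Y 0 \<or> c = 0"
  proof (rule disjCI)
    assume "c \<noteq> 0"
    then have "?X 1" "1 < n" using Xp[of 1] c(1) by auto
    then have "gamma_nonempty n D k" unfolding gamma_nonempty_def gamma_boxes_def by blast
    then obtain i where i: "i < n" "D (Ver k i) = Faucet_Elbow"
      using fv k by (auto simp: gamma_faucets_vertical_def)
    then have "?Y i" by (simp add: significant_def)
    then show "?Y 0" using Y[of i] i(1) by (cases "i = 0") auto
  qed
  \<comment> \<open>The faucet counts too: \<open>c\<close> horizontal crosses make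
    \<open>1 + c\<close> significant elements.\<close>
  define m where "m = (if ?Y 0 then 1 + c else 0)"
  have word: "sig_word D (gamma_list n k) = rev [0..<m]"
    unfolding sig_word_gamma_list fX fY m_def using ne by (auto simp: upt_conv_Cons[of 0] simp del: upt_Suc)
  then have m: "gamma_count n D k = m" by (simp add: gamma_count_eq)
  show "sig_word D (gamma_list n k) = rev [0..<gamma_count n D k]" using word m by simp
  show "gamma_count n D k \<le> n" using c(1) by (simp add: m m_def)
  show "?X p \<longleftrightarrow> 1 \<le> p \<and> p < gamma_count n D k" if "p < n" for p
    using Xp[OF that] ne by (auto simp: m m_def)
  show "?Y p \<longleftrightarrow> p = 0 \<and> 0 < gamma_count n D k" if "p < n" for p
    using Y[of p] that by (cases "p = 0") (auto simp: m m_def)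
qed

lemma stair_row_bottom:
  assumes D: "D \<in> signed_pipe_dreams n" and i: "1 \<le> i" "i < n" and la: "stair_left_adjusted n D"
  shows "sig_word D (stair_list n i) = rev [i..<i + stair_row_count n D i]"
    and "i + stair_row_count n D i \<le> n"
    and "\<And>j. 1 \<le> j \<Longrightarrow> j \<le> n - i \<Longrightarrow> significant D (Stair i j) \<longleftrightarrow> j \<le> stair_row_count n D i"
proof -
  let ?X = "\<lambda>p. significant D (Stair i (Suc p - i))"
  have box: "Stair i j \<in> stair_boxes n" if "1 \<le> j" "j \<le> n - i" for j
    using that i by (auto simp: stair_boxes_def)
  have "?X p" if "i \<le> p" "Suc p < n" "?X (Suc p)" for p
  proof -
    have b: "Stair i (Suc (Suc p) - i) \<in> stair_boxes n" using that by (intro box) auto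
    moreover have "D (Stair i (Suc (Suc p) - i)) = Cross"
      using that b pipe_dream_apply[OF D, of "Stair i (Suc (Suc p) - i)"] i by (auto simp: base_def)
    moreover have "1 \<le> Suc p - i" "Suc p - i < Suc (Suc p) - i" using that by auto
    ultimately have "D (Stair i (Suc p - i)) = Cross"
      using la unfolding stair_left_adjusted_def by blast
    then show ?thesis by (simp add: significant_def)
  qed
  then obtain c where c: "i + c \<le> n" "filter ?X [i..<n] = [i..<i + c]"
    using filter_upt_down_closed[of i n ?X] i by auto
  then have word: "sig_word D (stair_list n i) = rev [i..<i + c]"
    using i by (simp add: sig_word_stair_list rev_filter[symmetric])
  then have m: "stair_row_count n D i = c" using stair_row_count_eq[OF D i] by simp
  show "sig_word D (stair_list n i) = rev [i..<i + stair_row_count n D i]" using word m by simp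
  show "i + stair_row_count n D i \<le> n" using c m by simp
  show "significant D (Stair i j) \<longleftrightarrow> j \<le> stair_row_count n D i" if "1 \<le> j" "j \<le> n - i" for j
  proof -
    have "significant D (Stair i j) \<longleftrightarrow> i + j - 1 \<in> set (filter ?X [i..<n])"
      using that i by auto
    then show ?thesis unfolding c(2) m using that by auto
  qed
qed

lemma bottom_eqI:
  assumes n: "1 \<le> n" and D: "bottom_pipe_dream n w D" and D': "bottom_pipe_dream n w' D'"
    and stair: "\<And>i. 1 \<le> i \<Longrightarrow> i < n \<Longrightarrow> stair_row_count n D i = stair_row_count n D' i"
    and gamma: "\<And>k. 1 \<le> k \<Longrightarrow> gamma_count n D k = gamma_count n D' k"
  shows "D = D'"
proof (rule pipe_dream_eqI)
  show spd: "D \<in> signed_pipe_dreams n" "D' \<in> signed_pipe_dreams n"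
    using D D' by (auto simp: bottom_pipe_dream_def PD_def)
  note b = D[unfolded bottom_pipe_dream_def] D'[unfolded bottom_pipe_dream_def]
  fix b assume "b \<in> base n"
  then consider i j where "b = Stair i j" "1 \<le> i" "i < n" "1 \<le> j" "j \<le> n - i"
    | k p where "b = Hor k p" "1 \<le> k" "p < n" | k p where "b = Ver k p" "1 \<le> k" "p < n"
    by (fastforce simp: base_def stair_boxes_def gamma_boxes_def)
  then show "significant D b \<longleftrightarrow> significant D' b"
  proof cases
    case 1
    then show ?thesis
      using stair_row_bottom(3)[OF spd(1)] stair_row_bottom(3)[OF spd(2)] b stair by simp
  next
    case 2
    then show ?thesis
      using gamma_block_bottom(3)[OF spd(1) n] gamma_block_bottom(3)[OF spd(2) n] b gamma by simp
  next
    case 3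
    then show ?thesis
      using gamma_block_bottom(4)[OF spd(1) n] gamma_block_bottom(4)[OF spd(2) n] b gamma by simp
  qed
qed


section \<open>Terminal pipe dreams are bottom pipe dreams\<close>

text \<open>Terminality enters only through \<open>ascending\<close>: each box up to block
  \<open>K\<close> sees an ascent at its index.\<close>

context
  fixes n K :: nat and w :: "int \<Rightarrow> int" and D :: filling
  assumes n: "1 \<le> n" and D: "D \<in> PD n w"
    and K: "\<And>k. k > K \<Longrightarrow> \<not> gamma_nonempty n D k"
    and ascending: "\<And>xs b ys. boxes n K = xs @ b # ys
      \<Longrightarrow> asc (word_prod (sig_word D xs)) (box_index b)"
begin

text \<open>Block numbers grow against the reading direction: \<open>gstate (Suc k)\<close> is the
  product before block \<open>k\<close> is read, and \<open>gstate (Suc K)\<close> is the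
  identity.\<close>

private abbreviation "gstate k \<equiv> word_prod (sig_word D (gamma_part n k K))"

private definition sstate :: "nat \<Rightarrow> int \<Rightarrow> int" where
  "sstate r = word_prod (sig_word D (gamma_part n 1 K @ stair_part n 1 (Suc r)))"

private lemma spd: "D \<in> signed_pipe_dreams n"
  using D by (simp add: PD_def)

private lemma red: "reduced_word n w (sig_word D (boxes n K))"
  using D pd_word_eq[OF spd K] by (simp add: PD_def)

private lemma gstate_BC: "1 \<le> k \<Longrightarrow> gstate k \<in> BC n"
  by (intro word_prod_in_BC set_sig_word) (auto simp: set_gamma_part base_def)

section \<open>The staircase block of a terminal pipe dream\<close>

private lemma sstate_step:
  assumes "1 \<le> r"
  shows "sstate r = row_state (sstate (r - 1)) (\<lambda>p. significant D (Stair r (Suc p - r))) r n"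
  unfolding sstate_def stair_part_step[OF assms] row_state_def
  using assms by (simp add: sig_word_stair_list comp_assoc)

private lemma stair_asc:
  assumes "1 \<le> r" "r \<le> p" "p < n"
  shows "asc (row_state (sstate (r - 1)) (\<lambda>p. significant D (Stair r (Suc p - r))) (Suc p) n) p"
proof -
  obtain ys where ys: "boxes n K = (gamma_part n 1 K @ stair_part n 1 r) @ stair_list n r @ ys"
    using boxes_split_stair[of r n K] assms by auto
  let ?f = "\<lambda>p. Stair r (Suc p - r)"
  have "[r..<n] = [r..<p] @ p # [Suc p..<n]"
    using assms upt_add_eq_append[of r p "n - p"] by (simp add: upt_conv_Cons)
  then have "stair_list n r = map ?f (rev [Suc p..<n]) @ ?f p # map ?f (rev [r..<p])"
    by (simp add: stair_list_def)
  then have "boxes n K = (gamma_part n 1 K @ stair_part n 1 r @ map ?f (rev [Suc p..<n]))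
      @ ?f p # (map ?f (rev [r..<p]) @ ys)"
    using ys by simp
  from ascending[OF this]
  have "asc (sstate (r - 1) \<circ> word_prod (sig_word D (map ?f (rev [Suc p..<n])))) p"
    using assms by (simp add: sstate_def comp_assoc)
  moreover have "sig_word D (map ?f (rev [Suc p..<n]))
      = filter (\<lambda>p. significant D (Stair r (Suc p - r))) (rev [Suc p..<n])"
    using assms by (intro sig_word_map) auto
  ultimately show ?thesis by (simp add: row_state_def)
qed

text \<open>Row \<open>Suc r\<close> has the indices from \<open>Suc r\<close> to
  \<open>n - 1\<close>, so \<open>r < q\<close> says that this row meets a descent at
  \<open>q\<close>. The condition survives when row and position both grow by one.\<close>

private lemma sstate_asc:
  assumes "r < q" "q < n"
  shows "asc (sstate r) q"
  using assms
proof (induction "n - q" arbitrary: r q rule: less_induct)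
  case less
  show ?case
  proof (rule ccontr)
    assume "\<not> asc (sstate r) q"
    then have "Suc q < n \<and> \<not> asc (sstate (Suc r)) (Suc q)"
      using row_descent_shift[of "Suc r" q n "sstate r", OF _ _ _ _ stair_asc[of "Suc r", simplified]]
        less.prems
      by (simp add: sstate_step[of "Suc r"])
    moreover have "n - Suc q < n - q" using less.prems by simp
    ultimately show False using less.hyps[of "Suc q" "Suc r"] less.prems by blast
  qed
qed

private lemma left_adjusted: "stair_left_adjusted n D"
proof -
  let ?X = "\<lambda>i p. significant D (Stair i (Suc p - i))"
  have step: "?X i p" if "1 \<le> i" "i \<le> p" "Suc p < n" "?X i (Suc p)" for i p
  proof (rule ccontr)
    assume "\<not> ?X i p"
    then have "\<not> asc (sstate i) (Suc p)"
      using row_gap_descent[of i p n "?X i" "sstate (i - 1)"] stair_asc[of i "Suc p"] that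
      by (simp add: sstate_step[of i])
    then show False using sstate_asc[of i "Suc p"] that by simp
  qed
  have down: "?X i p" if "1 \<le> i" "q < n" "?X i q" "p \<le> q" "i \<le> p" for i p q
    using that(4,5) by (induction p rule: inc_induct) (use that step in auto)
  show ?thesis
    unfolding stair_left_adjusted_def
  proof (intro allI impI, elim conjE)
    fix i j j'
    assume a: "Stair i j \<in> stair_boxes n" "D (Stair i j) = Cross" "1 \<le> j'" "j' < j"
    then have i: "1 \<le> i" "i < n" "j \<le> n - i" by (auto simp: stair_boxes_def)
    have "?X i (i + j' - 1)"
      using down[of i "i + j - 1" "i + j' - 1"] a i by (simp add: significant_def)
    moreover have "Suc (i + j' - 1) - i = j'" using i a by simp
    ultimately have "significant D (Stair i j')" by simp
    moreover have "Stair i j' \<in> base n" using a i by (auto simp: base_def stair_boxes_def)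
    ultimately show "D (Stair i j') = Cross"
      using pipe_dream_apply[OF spd, of "Stair i j'"] i a by simp
  qed
qed

section \<open>The Gamma-blocks of a terminal pipe dream\<close>

private lemma gamma_hor_asc:
  assumes "1 \<le> k" "k \<le> K" "p < n"
  shows "asc (row_state (gstate (Suc k)) (\<lambda>p. significant D (Hor k p)) (Suc p) n) p"
proof -
  obtain ys where ys: "boxes n K = gamma_part n (Suc k) K @ gamma_list n k @ ys"
    using boxes_split_gamma[OF assms(1,2), of n] by auto
  have "[0..<n] = [0..<p] @ p # [Suc p..<n]"
    using assms upt_add_eq_append[of 0 p "n - p"] by (simp add: upt_conv_Cons)
  then have "boxes n K = (gamma_part n (Suc k) K @ map (Hor k) (rev [Suc p..<n]))
      @ Hor k p # (map (Hor k) (rev [0..<p]) @ map (Ver k) [0..<n] @ ys)"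
    using ys by (simp add: gamma_list_def)
  from ascending[OF this] show ?thesis
    by (simp add: row_state_def sig_word_map comp_assoc)
qed

private lemma gamma_ver_asc:
  assumes "1 \<le> k" "k \<le> K" "i < n"
  shows "asc (row_state (gstate (Suc k)) (\<lambda>p. significant D (Hor k p)) 0 n
    \<circ> word_prod (filter (\<lambda>p. significant D (Ver k p)) [0..<i])) i"
proof -
  obtain ys where ys: "boxes n K = gamma_part n (Suc k) K @ gamma_list n k @ ys"
    using boxes_split_gamma[OF assms(1,2), of n] by auto
  have "[0..<n] = [0..<i] @ i # [Suc i..<n]"
    using assms upt_add_eq_append[of 0 i "n - i"] by (simp add: upt_conv_Cons)
  then have "map (Ver k) [0..<n] = map (Ver k) [0..<i] @ Ver k i # map (Ver k) [Suc i..<n]"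
    by simp
  then have "boxes n K = (gamma_part n (Suc k) K @ map (Hor k) (rev [0..<n]) @ map (Ver k) [0..<i])
      @ Ver k i # (map (Ver k) [Suc i..<n] @ ys)"
    using ys unfolding gamma_list_def by simp
  from ascending[OF this] show ?thesis
    by (simp add: row_state_def sig_word_map comp_assoc)
qed

private lemma gstate_step:
  assumes "k \<le> K"
  shows "gstate k = row_state (gstate (Suc k)) (\<lambda>p. significant D (Hor k p)) 0 n
    \<circ> word_prod (filter (\<lambda>p. significant D (Ver k p)) [0..<n])"
  using assms by (simp add: gamma_part_step sig_word_gamma_list row_state_def comp_assoc)

private lemma block_shape:
  assumes k: "1 \<le> k" "k \<le> K" and fin: "\<And>q. 1 \<le> q \<Longrightarrow> q < n \<Longrightarrow> asc (gstate k) q"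
  shows "\<And>i. 1 \<le> i \<Longrightarrow> i < n \<Longrightarrow> \<not> significant D (Ver k i)"
    and "\<not> significant D (Hor k 0)"
    and "\<And>p. 1 \<le> p \<Longrightarrow> Suc p < n \<Longrightarrow> significant D (Hor k (Suc p)) \<Longrightarrow> significant D (Hor k p)"
    and "\<And>q. 1 \<le> q \<Longrightarrow> q < n \<Longrightarrow> asc (gstate (Suc k)) q"
    and "\<not> significant D (Ver k 0) \<Longrightarrow> \<forall>b\<in>set (gamma_part n k K). \<not> significant D b"
proof -
  let ?X = "\<lambda>p. significant D (Hor k p)" and ?Y = "\<lambda>p. significant D (Ver k p)"
  note shape = gamma_block_shape[of "gstate (Suc k)" n ?X ?Y, OF gstate_BC n
    gamma_hor_asc[OF k] gamma_ver_asc[OF k] fin[unfolded gstate_step[OF k(2)]]]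
  show noY: "\<not> ?Y i" if "1 \<le> i" "i < n" for i using shape(1) that by simp
  \<comment> \<open>Without the faucet the product of everything before the vertical part is the
    identity, and a prefix of a reduced word with this product is empty. The remaining conclusions
    are then immediate.\<close>
  have empty: "\<forall>b\<in>set (gamma_part n (Suc k) K @ map (Hor k) (rev [0..<n])). \<not> significant D b"
    if "\<not> ?Y 0"
  proof -
    let ?xs = "gamma_part n (Suc k) K @ map (Hor k) (rev [0..<n])"
    have "word_prod (sig_word D ?xs) = row_state (gstate (Suc k)) ?X 0 n"
      by (simp add: row_state_def sig_word_map)
    then have "word_prod (sig_word D ?xs) = id" using shape(2) that by simp
    moreover obtain ys where "boxes n K = ?xs @ ys"
      using boxes_split_gamma[OF k, of n] by (auto simp: gamma_list_def)
    ultimately have "sig_word D ?xs = []"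
      using red reduced_word_prefix_Nil[of n w "sig_word D ?xs" "sig_word D ys"]
      by (simp only: sig_word_append)
    then show ?thesis unfolding sig_word_eq_Nil_iff .
  qed
  show X0: "\<not> ?X 0"
    using shape(3) empty n by (cases "?Y 0") auto
  show "?X p" if "1 \<le> p" "Suc p < n" "?X (Suc p)" for p
    using shape(4)[of p] empty that by (cases "?Y 0") auto
  show "asc (gstate (Suc k)) q" if "1 \<le> q" "q < n" for q
  proof (cases "?Y 0")
    case True
    then show ?thesis using shape(5) that by simp
  next
    case False
    then have "sig_word D (gamma_part n (Suc k) K) = []" using empty by (simp add: sig_word_eq_Nil_iff)
    then show ?thesis using that by (simp add: asc_Suc)
  qed
  show "\<forall>b\<in>set (gamma_part n k K). \<not> significant D b" if Y0: "\<not> ?Y 0"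
  proof -
    have "\<not> ?Y i" if "i < n" for i using Y0 noY[of i] that by (cases "i = 0") auto
    then show ?thesis using empty[OF Y0] k by (auto simp: gamma_part_step gamma_list_def)
  qed
qed

text \<open>The induction climbs against the reading direction: \<open>gstate 1\<close> is
  \<open>sstate 0\<close>, covered by the staircase, and each block passes the ascents on to the
  product above it.\<close>

private lemma gstate_asc:
  assumes "1 \<le> k" "k \<le> Suc K"
  shows "\<And>q. 1 \<le> q \<Longrightarrow> q < n \<Longrightarrow> asc (gstate k) q"
  using assms
proof (induction k rule: dec_induct)
  case base
  then show ?case using sstate_asc[of 0] by (simp add: sstate_def stair_part_def)
next
  case (step k)
  then show ?case using block_shape(4)[of k] by simp
qed

private lemma empty_above:
  assumes "1 \<le> k" "p < n" "k > K"
  shows "\<not> significant D (Hor k p)" "\<not> significant D (Ver k p)"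
  using K[OF assms(3)] assms(2) by (auto simp: gamma_nonempty_def gamma_boxes_def)

private lemma faucets_vertical: "gamma_faucets_vertical n D"
  unfolding gamma_faucets_vertical_def
proof (intro allI impI)
  fix k assume k: "1 \<le> k" "gamma_nonempty n D k"
  then have "k \<le> K" using K not_less by blast
  have "significant D (Ver k 0)"
  proof (rule ccontr)
    assume "\<not> significant D (Ver k 0)"
    then have "\<forall>b\<in>set (gamma_part n k K). \<not> significant D b"
      using block_shape(5)[OF k(1) \<open>k \<le> K\<close>] gstate_asc k \<open>k \<le> K\<close> by simp
    then show False using k(2) \<open>k \<le> K\<close> by (auto simp: set_gamma_part gamma_nonempty_def)
  qed
  then have "D (Ver k 0) = Faucet_Elbow"
    using pipe_dream_apply[OF spd, of "Ver k 0"] gamma_boxes_base[OF k(1)] n by simp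
  then show "\<exists>i<n. D (Ver k i) = Faucet_Elbow" using n by (intro exI[of _ 0]) auto
qed

private lemma crosses_horizontal: "gamma_crosses_horizontal n D"
  unfolding gamma_crosses_horizontal_def
proof (intro allI impI)
  fix k :: nat assume k: "1 \<le> k"
  note base = gamma_boxes_base[OF k]
  have sh: "\<And>i. 1 \<le> i \<Longrightarrow> i < n \<Longrightarrow> \<not> significant D (Ver k i)" "\<not> significant D (Hor k 0)"
    "\<And>p. 1 \<le> p \<Longrightarrow> Suc p < n \<Longrightarrow> significant D (Hor k (Suc p)) \<Longrightarrow> significant D (Hor k p)"
    using block_shape(1-3)[OF k] gstate_asc[of k] empty_above[of k] k n
    by (cases "k \<le> K"; auto)+
  have down: "significant D (Hor k p)" if "q < n" "significant D (Hor k q)" "p \<le> q" "1 \<le> p" for p q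
    using that(3,4) by (induction p rule: inc_induct) (use that sh(3) in auto)
  have "D (Ver k i) \<noteq> Cross" if "i < n" for i
    using pipe_dream_apply[OF spd, of "Ver k i"] base[OF that] sh(1)[of i] that by auto
  moreover have "D (Hor k 0) = Single_Elbow"
    using pipe_dream_apply[OF spd, of "Hor k 0"] base[of 0] sh(2) n by auto
  moreover have "D (Hor k i') = Cross" if "i < n" "D (Hor k i) = Cross" "1 \<le> i'" "i' < i" for i i'
    using pipe_dream_apply[OF spd, of "Hor k i'"] base[of i'] down[of i i'] that
    by (simp add: significant_def)
  ultimately show "(\<forall>i<n. D (Ver k i) \<noteq> Cross) \<and> D (Hor k 0) = Single_Elbow \<and>
      (\<forall>i i'. i < n \<and> D (Hor k i) = Cross \<and> 1 \<le> i' \<and> i' < i \<longrightarrow> D (Hor k i') = Cross)"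
    by blast
qed

private lemma counts_decreasing: "gamma_counts_decreasing n D"
proof -
  let ?c = "gamma_count n D"
  note shape = gamma_block_bottom[OF spd n _ faucets_vertical crosses_horizontal]
  have c0: "?c k = 0" if "k > K" for k
    using gamma_count_zero K that by blast
  have main: "block_state (gstate k) (?c k) \<and> (k \<le> K \<longrightarrow> ?c (k + 1) < ?c k \<or> ?c k = 0 \<and> ?c (k + 1) = 0)"
    if "k \<le> Suc K" "1 \<le> k" for k
    using that
  proof (induction k rule: inc_induct)
    case base
    then show ?case using c0[of "Suc K"] by (simp add: gamma_part_empty block_state_def)
  next
    case (step k)
    then have k: "1 \<le> k" "k \<le> K" by auto
    have st: "block_state (gstate (Suc k)) (?c (Suc k))" using step by simp
    have gs: "gstate k = gstate (Suc k) \<circ> word_prod (rev [0..<?c k])"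
      using k shape(1)[OF k(1)] by (simp add: gamma_part_step)
    show ?case
    proof (cases "?c k = 0")
      case True
      then have "\<not> significant D (Ver k 0)" using shape(4)[OF k(1), of 0] n by simp
      then have "\<forall>b\<in>set (gamma_part n k K). \<not> significant D b"
        using block_shape(5)[OF k] gstate_asc[of k] k by simp
      moreover have "set (gamma_part n (Suc k) K) \<subseteq> set (gamma_part n k K)"
        unfolding set_gamma_part by (intro UN_mono) auto
      moreover have "set (gamma_list n (Suc k)) \<subseteq> set (gamma_part n k K)" if "Suc k \<le> K"
        unfolding set_gamma_part set_gamma_list by (rule UN_upper) (use that in auto)
      ultimately have "\<not> gamma_nonempty n D (Suc k)"
        using K[of "Suc k"] unfolding gamma_nonempty_def set_gamma_list[symmetric]
        by (cases "Suc k \<le> K") auto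
      then have "?c (Suc k) = 0" by (rule gamma_count_zero)
      then show ?thesis using True st gs by simp
    next
      case False
      then have c: "1 \<le> ?c k" "?c k \<le> n" using shape(2)[OF k(1)] by auto
      \<comment> \<open>The first vertical box sees a positive value at 1. The left-adjusted crosses
        before it carry 1 to the count of the block, so \<open>gstate (Suc k)\<close> is positive at
        this count, as \<open>count_less\<close> requires.\<close>
      have "row_state (gstate (Suc k)) (\<lambda>p. significant D (Hor k p)) 0 n 1 > 0"
        using gamma_ver_asc[OF k, of 0] n BC_minus[OF BC_row_state[OF gstate_BC]] by (simp add: asc_0)
      moreover have "filter (\<lambda>p. significant D (Hor k p)) (rev [0..<n]) = rev [1..<?c k]"
      proof -
        have "filter (\<lambda>p. significant D (Hor k p)) [0..<n] = filter (\<lambda>p. 1 \<le> p \<and> p < ?c k) [0..<n]"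
          using shape(3)[OF k(1)] by (intro filter_cong) auto
        also have "\<dots> = [1..<?c k]"
          by (rule sorted_distinct_set_unique) (use c in \<open>auto simp: sorted_wrt_filter\<close>)
        finally show ?thesis by (simp only: rev_filter[symmetric])
      qed
      moreover have "word_prod (rev [1..<?c k]) 1 = int (?c k)"
        using word_prod_rev_upt[of 1 "?c k" 1] c by simp
      ultimately have "gstate (Suc k) (int (?c k)) > 0" by (simp add: row_state_def)
      then have "?c (Suc k) < ?c k"
        using gstate_asc[of k 1] k gs
        by (intro count_less[OF st c inj_word_prod word_prod_minus]) auto
      moreover from this have "block_state (gstate k) (?c k)"
        unfolding gs by (rule block_state_step[OF st _ word_prod_minus])
      ultimately show ?thesis by simp
    qed
  qed
  show ?thesis
    unfolding gamma_counts_decreasing_def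
  proof (intro allI impI)
    fix k :: nat assume "1 \<le> k"
    then show "?c (k + 1) < ?c k \<or> ?c k = 0 \<and> ?c (k + 1) = 0"
      using main[of k] c0[of k] c0[of "k + 1"] by (cases "k \<le> K") auto
  qed
qed

lemma ascending_imp_bottom: "bottom_pipe_dream n w D"
  using D left_adjusted faucets_vertical crosses_horizontal counts_decreasing
  by (simp add: bottom_pipe_dream_def)

end


section \<open>The code of a bottom pipe dream\<close>

lemma asc_strict_mono:
  assumes "\<And>q. lo \<le> q \<Longrightarrow> q < n \<Longrightarrow> asc u q" "1 \<le> lo" "lo \<le> p" "p < p'" "p' \<le> n"
  shows "u (int p) < u (int p')"
proof -
  have "Suc p \<le> p'" using assms(4) by simp
  then show ?thesis using assms(5)
  proof (induction p' rule: dec_induct)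
    case base
    then show ?case using assms(1)[of p] assms(2,3) by (simp add: asc_Suc del: of_nat_Suc)
  next
    case (step q)
    then have "asc u q" using assms(1)[of q] assms(3) by simp
    then have "u (int q) < u (int (Suc q))" using step assms(2) by (simp add: asc_Suc del: of_nat_Suc)
    moreover have "u (int p) < u (int q)" using step by simp
    ultimately show ?case by (rule less_trans[rotated])
  qed
qed

lemma word_prod_pos:
  assumes "0 \<notin> set u" "x > 0"
  shows "word_prod u x > 0"
  using assms(1)
proof (induction u)
  case (Cons i u)
  then show ?case by (cases "i = 0") (auto simp: gen_pos)
qed (use assms in simp)

text \<open>Staircase letters are positive, so the staircase cannot change which values come from
  negative arguments.\<close>

lemma word_prod_neg_iff:
  assumes "0 \<notin> set u"
  shows "word_prod u x < 0 \<longleftrightarrow> x < 0"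
  using word_prod_pos[OF assms, of x] word_prod_pos[OF assms, of "- x"] word_prod_minus[of u x]
  by (cases x "0 :: int" rule: linorder_cases) auto

lemma word_prod_image_interval:
  assumes "\<And>j. j \<in> set u \<Longrightarrow> i < j \<and> j < n"
  shows "word_prod u ` {int i<..int n} = {int i<..int n}"
proof -
  have "word_prod u ` {int i<..int n} \<subseteq> {int i<..int n}"
    using assms
  proof (induction u)
    case (Cons j u)
    have "gen j y \<in> {int i<..int n}" if "y \<in> {int i<..int n}" for y
      using that Cons.prems[of j] by (auto simp: gen_pos)
    then have "gen j ` {int i<..int n} \<subseteq> {int i<..int n}" by blast
    moreover have "word_prod u ` {int i<..int n} \<subseteq> {int i<..int n}"
      using Cons.IH Cons.prems by simp
    ultimately show ?case unfolding word_prod_Cons image_comp[symmetric] by blast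
  qed simp
  then show ?thesis
    by (intro card_subset_eq) (auto simp: card_image inj_on_subset[OF inj_word_prod])
qed

text \<open>If \<open>w\<close> arises from \<open>u\<close> by a left-adjusted row starting at \<open>i\<close> and rows below it, then the
  values at positions \<open>> i\<close> are only permuted by the lower rows.\<close>

lemma code_L_eq:
  assumes asc: "\<And>q. i \<le> q \<Longrightarrow> q < n \<Longrightarrow> asc u q" and i: "1 \<le> i" "i + d \<le> n"
    and v: "\<And>j. j \<in> set v \<Longrightarrow> i < j \<and> j < n"
    and w: "w = u \<circ> word_prod (rev [i..<i + d]) \<circ> word_prod v"
  shows "code_L n w i = d"
proof -
  let ?r = "word_prod (rev [i..<i + d])" and ?I = "{int i<..int n}"
  have r: "?r (int p) = (if p = i then int (i + d) else if i < p \<and> p \<le> i + d then int (p - 1) else int p)"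
    if "1 \<le> p" for p
    using word_prod_rev_upt[of i "i + d" p] i that by (auto simp: of_nat_diff)
  have "word_prod v (int i) = int i" using i v by (intro word_prod_fixes) force+
  then have wi: "w (int i) = u (int (i + d))" using r[of i] i by (simp add: w)
  have mono: "u (int p) < u (int p')" if "i \<le> p" "p < p'" "p' \<le> n" for p p'
    using asc_strict_mono[of i n u p p'] asc i that by blast
  have I: "?I = int ` {i<..n}"
  proof (intro equalityI subsetI)
    fix x assume "x \<in> ?I"
    then show "x \<in> int ` {i<..n}" by (intro image_eqI[of _ _ "nat x"]) auto
  qed auto
  have "code_L n w i = card {j \<in> {i<..n}. w (int j) < w (int i)}"
    unfolding code_L_def by (intro arg_cong[of _ _ card]) auto
  also have "\<dots> = card (int ` {j \<in> {i<..n}. w (int j) < w (int i)})"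
    by (simp add: card_image)
  also have "int ` {j \<in> {i<..n}. w (int j) < w (int i)} = {x \<in> ?I. w x < w (int i)}"
    unfolding I by auto
  also have "card \<dots> = card (word_prod v ` {x \<in> ?I. w x < w (int i)})"
    by (simp add: card_image inj_on_subset[OF inj_word_prod])
  also have "word_prod v ` {x \<in> ?I. w x < w (int i)} = {y \<in> word_prod v ` ?I. u (?r y) < w (int i)}"
    by (auto simp: w)
  also have "\<dots> = {y \<in> ?I. u (?r y) < w (int i)}"
    using word_prod_image_interval[of v i n] v by simp
  also have "\<dots> = int ` {j \<in> {i<..n}. u (?r (int j)) < u (int (i + d))}"
    unfolding I wi by auto
  also have "card \<dots> = card {j \<in> {i<..n}. u (?r (int j)) < u (int (i + d))}"
    by (simp add: card_image)
  \<comment> \<open>The row brings \<open>u (i + d)\<close> to position \<open>i\<close> and moves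
    \<open>u (j - 1)\<close> to \<open>j\<close> for \<open>j\<close> up to \<open>i + d\<close>. As
    \<open>u\<close> increases from \<open>i\<close> on, exactly these \<open>d\<close> values are
    smaller.\<close>
  also have "{j \<in> {i<..n}. u (?r (int j)) < u (int (i + d))} = {i<..i + d}"
  proof (rule set_eqI)
    fix j
    show "j \<in> {j \<in> {i<..n}. u (?r (int j)) < u (int (i + d))} \<longleftrightarrow> j \<in> {i<..i + d}"
    proof (cases "i < j \<and> j \<le> n")
      case True
      then show ?thesis
        using r[of j] mono[of "j - 1" "i + d"] mono[of "i + d" j] i by (cases "j \<le> i + d") auto
    next
      case False
      then show ?thesis using i by auto
    qed
  qed
  finally show ?thesis by simp
qed

text \<open>Beyond position \<open>i\<close> stands the increasing sequence \<open>u i\<close>, ...,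
  \<open>u n\<close> with the one value \<open>u (i + d)\<close> taken out.\<close>

lemma stair_step_asc:
  assumes asc: "\<And>q. i \<le> q \<Longrightarrow> q < n \<Longrightarrow> asc u q" and i: "1 \<le> i" "i + d \<le> n"
    and q: "i < q" "q < n"
  shows "asc (u \<circ> word_prod (rev [i..<i + d])) q"
proof -
  have r: "word_prod (rev [i..<i + d]) (int p)
    = (if p = i then int (i + d) else if i < p \<and> p \<le> i + d then int (p - 1) else int p)"
    if "1 \<le> p" for p
    using word_prod_rev_upt[of i "i + d" p] i that by (auto simp: of_nat_diff)
  have mono: "u (int p) < u (int p')" if "i \<le> p" "p < p'" "p' \<le> n" for p p'
    using asc_strict_mono[of i n u p p'] asc i that by blast
  show ?thesis
    using r[of q] r[of "Suc q"] q i mono[of "q - 1" q] mono[of "q - 1" "Suc q"] mono[of q "Suc q"]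
    by (auto simp: asc_Suc simp del: of_nat_Suc)
qed

section \<open>Gamma-counts and the part \<open>code_N\<close> of the code\<close>

lemma neg_values_eq:
  assumes w: "w \<in> BC n"
  shows "{m \<in> {1..n}. inv w (int m) < 0} = neg_values w"
proof -
  have p: "w permutes signed_points n" using w by (simp add: BC_def)
  have "w x = int m \<longleftrightarrow> x = inv w (int m)" for x m
    using permutes_inverses[OF p] by metis
  moreover have "m \<le> n" if "1 \<le> m" "x < 0" "w x = int m" for x m
  proof (rule ccontr)
    assume "\<not> m \<le> n"
    then have "w (int m) = int m"
      using p unfolding permutes_def signed_points_def by simp
    then have "x = int m" using that injD[OF permutes_inj[OF p], of x "int m"] by simp
    then show False using that by simp
  qed
  ultimately show ?thesis unfolding neg_values_def by fastforce
qed

lemma num_neg_eq: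
  assumes w: "w \<in> BC n"
  shows "num_neg n w = card (neg_values w)"
proof -
  have p: "w permutes signed_points n" using w by (simp add: BC_def)
  let ?A = "{i \<in> {1..n}. w (int i) < 0}"
  have "inj_on (\<lambda>i. nat (- w (int i))) ?A"
  proof (rule inj_onI)
    fix i j assume "i \<in> ?A" "j \<in> ?A" "nat (- w (int i)) = nat (- w (int j))"
    then have "w (int i) = w (int j)" by auto
    then show "i = j" using injD[OF permutes_inj[OF p], of "int i" "int j"] by simp
  qed
  moreover have "(\<lambda>i. nat (- w (int i))) ` ?A = neg_values w"
  proof (intro equalityI subsetI)
    fix m assume "m \<in> (\<lambda>i. nat (- w (int i))) ` ?A"
    then obtain i where "i \<in> ?A" "m = nat (- w (int i))" by blast
    then have "w (- int i) = int m" "1 \<le> m" "- int i < 0" using BC_minus[OF w, of "int i"] by auto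
    then show "m \<in> neg_values w" unfolding neg_values_def by blast
  next
    fix m assume "m \<in> neg_values w"
    then obtain x where x: "x < 0" "w x = int m" and m: "1 \<le> m" by (auto simp: neg_values_def)
    have "w (- x) = - int m" using x BC_minus[OF w] by simp
    moreover have "- x \<le> int n"
    proof (rule ccontr)
      assume "\<not> - x \<le> int n"
      then have "w x = x" using p x unfolding permutes_def signed_points_def by simp
      then show False using x by simp
    qed
    ultimately have "nat (- x) \<in> ?A" "m = nat (- w (int (nat (- x))))"
      using x m by auto
    then show "m \<in> (\<lambda>i. nat (- w (int i))) ` ?A" by (rule rev_image_eqI)
  qed
  ultimately show ?thesis
    using card_image[of "\<lambda>i. nat (- w (int i))" ?A] by (simp only: num_neg_def)
qed

text \<open>The positive terms of \<open>c\<close> come first and decrease strictly, so they can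
  only be the decreasing enumeration of the set of these terms.\<close>

lemma code_N_eq:
  assumes w: "w \<in> BC n" and dec: "\<And>k. 1 \<le> k \<Longrightarrow> c (Suc k) < c k \<or> c k = 0 \<and> c (Suc k) = 0"
    and neg: "neg_values w = {c k | k. 1 \<le> k \<and> 0 < c k}" and j: "1 \<le> j"
  shows "code_N n w j = c j"
proof -
  have fin: "finite (neg_values w)"
    unfolding neg_values_eq[OF w, symmetric] by simp
  have anti: "c k' < c k \<or> c k' = 0" if "1 \<le> k" "k < k'" for k k'
  proof -
    have "Suc k \<le> k'" using that by simp
    then show ?thesis
    proof (induction k' rule: dec_induct)
      case base
      then show ?case using dec[of k] that by auto
    next
      case (step m)
      then show ?case using dec[of m] that by auto
    qed
  qed
  \<comment> \<open>A sequence positive everywhere would embed an infinite set into the finite set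
    of negative values.\<close>
  have "\<exists>k\<ge>1. c k = 0"
  proof (rule ccontr)
    assume "\<not> (\<exists>k\<ge>1. c k = 0)"
    then have pos: "\<And>k. 1 \<le> k \<Longrightarrow> 0 < c k" by auto
    then have "c ` {1..} \<subseteq> neg_values w" unfolding neg by auto
    moreover have "inj_on c {1..}"
    proof (rule inj_onI)
      fix x y assume "x \<in> {1..}" "y \<in> {1..}" "c x = c y"
      then show "x = y" using anti[of x y] anti[of y x] pos[of x] pos[of y]
        by (cases x y rule: linorder_cases) auto
    qed
    ultimately have "finite {1 :: nat..}" using fin finite_subset finite_imageD by metis
    then show False using infinite_Ici by blast
  qed
  then obtain k where k: "1 \<le> k" "c k = 0" by blast
  \<comment> \<open>The positive terms are exactly those at indices below the first zero; indexing
    from 1 makes their number \<open>L - 1\<close>.\<close>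
  define L where "L = (LEAST k. 1 \<le> k \<and> c k = 0)"
  have L: "1 \<le> L" "c L = 0" using LeastI[of "\<lambda>k. 1 \<le> k \<and> c k = 0" k] k unfolding L_def by auto
  have posL: "0 < c i" if "1 \<le> i" "i < L" for i
    using not_less_Least[of i "\<lambda>k. 1 \<le> k \<and> c k = 0"] that unfolding L_def by auto
  have zero: "c i = 0" if "L \<le> i" for i
    using anti[of L i] L that by (cases "L = i") auto
  have "1 \<le> k \<and> 0 < c k \<longleftrightarrow> k \<in> {1..<L}" for k
    using posL[of k] zero[of k] by (cases "k < L") auto
  then have set: "neg_values w = c ` {1..<L}"
    unfolding neg by blast
  have "sorted_wrt (\<lambda>x y. c x > c y) [1..<L]"
  proof (rule sorted_wrt_mono_rel[OF _ sorted_wrt_upt])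
    fix x y assume "x \<in> set [1..<L]" "y \<in> set [1..<L]" "x < y"
    then show "c x > c y" using anti[of x y] posL[of y] by auto
  qed
  then have "sorted_wrt (>) (map c [1..<L])" by (simp add: sorted_wrt_map)
  then have s: "sorted_wrt (<) (rev (map c [1..<L]))" by (simp add: sorted_wrt_rev)
  then have sd: "sorted (rev (map c [1..<L])) \<and> distinct (rev (map c [1..<L]))"
    using strict_sorted_iff by blast
  have "sorted_list_of_set (neg_values w) = rev (map c [1..<L])"
    using sd sorted_list_of_set.idem_if_sorted_distinct[of "rev (map c [1..<L])"] by (simp add: set)
  then have list: "code_N_list n w = map c [1..<L]"
    unfolding code_N_list_def neg_values_eq[OF w] by simp
  have "card (neg_values w) = length (rev (map c [1..<L]))"
    using sd distinct_card[of "rev (map c [1..<L])"] by (simp add: set)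
  then have num: "num_neg n w = L - 1" by (simp add: num_neg_eq[OF w])
  show ?thesis
    unfolding code_N_def num list using j zero[of j] L by auto
qed

lemma bottom_counts:
  assumes n: "1 \<le> n" and w: "w \<in> BC n" and bot: "bottom_pipe_dream n w D"
  shows "\<And>i. i \<in> {1..n} \<Longrightarrow> stair_row_count n D i = code_L n w i"
    and "\<And>j. 1 \<le> j \<Longrightarrow> gamma_count n D j = code_N n w j"
proof -
  note b = bot[unfolded bottom_pipe_dream_def]
  have spd: "D \<in> signed_pipe_dreams n" using b by (simp add: PD_def)
  let ?c = "gamma_count n D" and ?d = "stair_row_count n D"
  note gshape = gamma_block_bottom[OF spd n]
  note sshape = stair_row_bottom[OF spd]
  obtain K where K: "\<And>k. k > K \<Longrightarrow> \<not> gamma_nonempty n D k" using gamma_bound_exists[OF spd] by blast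
  have c0: "?c k = 0" if "k > K" for k
    using gamma_count_zero K that by blast
  have dec: "?c (Suc k) < ?c k \<or> ?c k = 0 \<and> ?c (Suc k) = 0" if "1 \<le> k" for k
    using b that by (simp add: gamma_counts_decreasing_def)
  let ?g = "\<lambda>k. word_prod (sig_word D (gamma_part n k K))"
  \<comment> \<open>\<open>block_state\<close> carries the other two invariants from block to block;
    the ascents start the staircase count, and the negative values yield
    \<open>code_N\<close>.\<close>
  have G: "block_state (?g k) (?c k) \<and> (\<forall>q. 1 \<le> q \<and> q < n \<longrightarrow> asc (?g k) q)
      \<and> neg_values (?g k) = {?c j | j. k \<le> j \<and> 0 < ?c j}" if "k \<le> Suc K" "1 \<le> k" for k
    using that
  proof (induction k rule: inc_induct)
    case base
    have "?g (Suc K) = id" by (simp add: gamma_part_empty)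
    moreover have "neg_values id = {}" by (auto simp: neg_values_def)
    moreover have "{?c j | j. Suc K \<le> j \<and> 0 < ?c j} = {}" using c0 by fastforce
    ultimately show ?case using c0[of "Suc K"] by (simp only:) (simp add: block_state_def asc_Suc)
  next
    case (step k)
    then have k: "1 \<le> k" "k \<le> K" and
      st: "block_state (?g (Suc k)) (?c (Suc k))" and
      asc: "\<And>q. 1 \<le> q \<Longrightarrow> q < n \<Longrightarrow> asc (?g (Suc k)) q" and
      neg: "neg_values (?g (Suc k)) = {?c j | j. Suc k \<le> j \<and> 0 < ?c j}" by auto
    have gs: "?g k = ?g (Suc k) \<circ> word_prod (rev [0..<?c k])"
      using gshape(1)[OF k(1)] b k by (simp add: gamma_part_step)
    have split: "{?c j | j. k \<le> j \<and> 0 < ?c j}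
      = (if ?c k = 0 then {} else {?c k}) \<union> {?c j | j. Suc k \<le> j \<and> 0 < ?c j}"
      by (auto simp: Suc_le_eq le_less)
    show ?case
    proof (cases "?c k = 0")
      case True
      then have "?c (Suc k) = 0" using dec[OF k(1)] by auto
      then show ?thesis using st asc neg split True by (simp add: gs)
    next
      case False
      then have less: "?c (Suc k) < ?c k" using dec[OF k(1)] by auto
      have cn: "?c k \<le> n" using gshape(2)[OF k(1)] b by blast
      show ?thesis
        unfolding gs neg_values_step[OF st less word_prod_minus] neg split
      proof (intro conjI allI impI)
        show "block_state (?g (Suc k) \<circ> word_prod (rev [0..<?c k])) (?c k)"
          by (rule block_state_step[OF st less word_prod_minus])
        show "asc (?g (Suc k) \<circ> word_prod (rev [0..<?c k])) q" if "1 \<le> q \<and> q < n" for q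
          using that by (intro block_state_asc[OF st less cn inj_word_prod word_prod_minus asc]) auto
      qed (use False in simp)
    qed
  qed
  let ?s = "\<lambda>r. word_prod (sig_word D (gamma_part n 1 K @ stair_part n 1 (Suc r)))"
  have s0: "?s 0 = ?g 1" by (simp add: stair_part_def)
  have s_step: "?s (Suc r) = ?s r \<circ> word_prod (rev [Suc r..<Suc r + ?d (Suc r)])" if "Suc r < n" for r
  proof -
    have "1 \<le> Suc r" by simp
    then show ?thesis
      using sshape(1)[of "Suc r"] b that
      by (simp only: stair_part_step sig_word_append word_prod_append comp_assoc)
  qed
  have s_asc: "asc (?s r) q" if "r < q" "q < n" for r q
    using that
  proof (induction r arbitrary: q)
    case 0
    then show ?case unfolding s0 using G[of 1] by simp
  next
    case (Suc r)
    then have "Suc r < n" by simp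
    show ?case
      unfolding s_step[OF \<open>Suc r < n\<close>]
    proof (rule stair_step_asc)
      show "asc (?s r) p" if "Suc r \<le> p" "p < n" for p
        using Suc.IH[of p] that by (simp only: Suc_le_eq)
    qed (use sshape(2)[of "Suc r"] b Suc.prems in auto)
  qed
  \<comment> \<open>The rows below row \<open>r\<close> use only letters above \<open>r\<close>. For
    \<open>r = 0\<close> this says that the staircase contains no \<open>s_0\<close>.\<close>
  have tail: "\<exists>v. w = ?s r \<circ> word_prod v \<and> (\<forall>j\<in>set v. r < j \<and> j < n)" if "r < n" for r
  proof -
    let ?v = "sig_word D (stair_part n (Suc r) n)"
    have "[1..<n] = [1..<Suc r] @ [Suc r..<n]"
      using that upt_add_eq_append[of 1 "Suc r" "n - Suc r"] by simp
    then have "boxes n K = (gamma_part n 1 K @ stair_part n 1 (Suc r)) @ stair_part n (Suc r) n"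
      by (simp add: boxes_def stair_part_def del: upt_Suc)
    moreover have "w = word_prod (sig_word D (boxes n K))"
      using b pd_word_eq[OF spd K] by (simp add: PD_def reduced_word_def word_for_def)
    ultimately have "w = ?s r \<circ> word_prod ?v"
      by (simp only: sig_word_append word_prod_append)
    moreover have "\<forall>j\<in>set ?v. r < j \<and> j < n"
      by (auto simp: sig_word_def stair_part_def stair_list_def)
    ultimately show ?thesis by blast
  qed
  show "?d i = code_L n w i" if "i \<in> {1..n}" for i
  proof (cases "i = n")
    case True
    have "{j. Stair n j \<in> stair_boxes n \<and> D (Stair n j) = Cross} = {}" by (auto simp: stair_boxes_def)
    moreover have "{j. n < j \<and> j \<le> n \<and> w (int n) > w (int j)} = {}" by auto
    ultimately show ?thesis unfolding True stair_row_count_def code_L_def by (simp only: card.empty)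
  next
    case False
    then have i: "1 \<le> i" "i < n" using that by auto
    obtain v where v: "w = ?s i \<circ> word_prod v" "\<forall>j\<in>set v. i < j \<and> j < n" using tail[OF i(2)] by blast
    obtain r where r: "i = Suc r" using i(1) by (cases i) auto
    have "code_L n w i = ?d i"
    proof (rule code_L_eq)
      show "w = ?s r \<circ> word_prod (rev [i..<i + ?d i]) \<circ> word_prod v"
        using v(1) s_step[of r] i(2) unfolding r by simp
      show "asc (?s r) q" if "i \<le> q" "q < n" for q using s_asc[of r q] that r by simp
    qed (use i v sshape(2)[OF i] b in auto)
    then show ?thesis ..
  qed
  have "neg_values w = neg_values (?g 1)"
  proof -
    obtain v where v: "w = ?g 1 \<circ> word_prod v" "\<forall>j\<in>set v. 0 < j \<and> j < n"
      using tail[of 0] n unfolding s0 by auto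
    have v0: "0 \<notin> set v" using v(2) by auto
    have "(\<exists>x<0. w x = y) \<longleftrightarrow> (\<exists>x<0. ?g 1 x = y)" for y
    proof
      assume "\<exists>x<0. w x = y"
      then show "\<exists>x<0. ?g 1 x = y" using v(1) word_prod_neg_iff[OF v0] by auto
    next
      assume "\<exists>x<0. ?g 1 x = y"
      then obtain x where x: "x < 0" "?g 1 x = y" by blast
      have "word_prod v \<in> BC n" using v(2) by (intro word_prod_in_BC) auto
      then have "surj (word_prod v)" by (auto simp: BC_def permutes_surj)
      then obtain z where z: "x = word_prod v z" by (auto dest: surjD)
      then have "z < 0" using x word_prod_neg_iff[OF v0] by simp
      then show "\<exists>x<0. w x = y" using v(1) x z by auto
    qed
    then show ?thesis by (simp add: neg_values_def)
  qed
  then have "neg_values w = {?c j | j. 1 \<le> j \<and> 0 < ?c j}" using G[of 1] by simp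
  then show "?c j = code_N n w j" if "1 \<le> j" for j
    using code_N_eq[where c = ?c, OF w dec _ that] by simp
qed


section \<open>Existence and reachability\<close>

text \<open>Each block has a vertical box for every letter, so any reduced word becomes the word of
  a pipe dream when it is spread over the blocks, one letter in each.\<close>

lemma PD_nonempty:
  assumes w: "w \<in> BC n"
  shows "PD n w \<noteq> {}"
proof -
  obtain u where u: "reduced_word n w u" using reduced_word_exists[OF w] by blast
  let ?l = "length u"
  \<comment> \<open>Blocks are read from the top, so block \<open>?l\<close> receives the first
    letter \<open>u ! 0\<close> and block 1 the last one.\<close>
  define S where "S = {Ver k (u ! (?l - k)) | k. 1 \<le> k \<and> k \<le> ?l}"
  define D where "D = filling_of n S"
  have S: "S = (\<lambda>k. Ver k (u ! (?l - k))) ` {1..?l}" by (auto simp: S_def)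
  have D: "D \<in> signed_pipe_dreams n"
    unfolding D_def by (rule filling_of_in_signed_pipe_dreams) (simp add: S)
  have less: "u ! (?l - k) < n" if "1 \<le> k" "k \<le> ?l" for k
  proof -
    have "u ! (?l - k) \<in> set u" using that by (intro nth_mem) auto
    then show ?thesis using u by (auto simp: reduced_word_def word_for_def)
  qed
  have hor: "\<not> significant D (Hor k p)" if "1 \<le> k" "p < n" for k p
    using that by (auto simp: D_def significant_filling_of S_def gamma_boxes_base)
  have ver: "significant D (Ver k p) \<longleftrightarrow> k \<le> ?l \<and> p = u ! (?l - k)" if "1 \<le> k" "p < n" for k p
    using that by (auto simp: D_def significant_filling_of S_def gamma_boxes_base)
  have stair: "\<not> significant D b" if "b \<in> set (stair_part n 1 n)" for b
  proof -
    have "b \<in> stair_boxes n" using that by (auto simp: stair_part_def stair_boxes_def set_stair_list)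
    then show ?thesis by (auto simp: D_def significant_filling_of S_def base_def stair_boxes_def)
  qed
  have "\<not> gamma_nonempty n D k" if "k > ?l" for k
    using hor[of k] ver[of k] that by (auto simp: gamma_nonempty_def gamma_boxes_def)
  from pd_word_eq[OF D this]
  have "pd_word n D = sig_word D (boxes n ?l)" .
  also have "\<dots> = sig_word D (gamma_part n 1 ?l)"
    using stair by (simp add: boxes_def sig_word_eq_Nil_iff)
  also have "\<dots> = u"
  proof -
    have word: "sig_word D (gamma_list n k) = [u ! (?l - k)]" if k: "1 \<le> k" "k \<le> ?l" for k
    proof -
      let ?p = "u ! (?l - k)"
      have "[0..<n] = [0..<?p] @ ?p # [Suc ?p..<n]"
        using less[OF k] upt_add_eq_append[of 0 ?p "n - ?p"] by (simp add: upt_conv_Cons)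
      moreover have "filter (\<lambda>p. significant D (Hor k p)) (rev [0..<n]) = []"
        using hor k by (auto simp: filter_empty_conv)
      moreover have "filter (\<lambda>p. significant D (Ver k p)) [0..<?p] = []"
        "filter (\<lambda>p. significant D (Ver k p)) [Suc ?p..<n] = []" "significant D (Ver k ?p)"
        using ver k less[OF k] by (auto simp: filter_empty_conv)
      ultimately show ?thesis unfolding sig_word_gamma_list by simp
    qed
    have "sig_word D (gamma_part n m ?l) = take (Suc ?l - m) u" if "m \<le> Suc ?l" "1 \<le> m" for m
      using that
    proof (induction m rule: inc_induct)
      case base
      then show ?case by (simp add: gamma_part_empty)
    next
      case (step m)
      then have m: "1 \<le> m" "m \<le> ?l" by auto
      have "Suc ?l - m = Suc (?l - m)" "Suc ?l - Suc m = ?l - m" using m by auto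
      then show ?case
        using step word[OF m] m by (simp add: gamma_part_step take_Suc_conv_app_nth)
    qed
    from this[of 1] show ?thesis by simp
  qed
  finally have "D \<in> PD n w" using D u by (simp add: PD_def)
  then show ?thesis by blast
qed

text \<open>Moves lower the total height of the significant boxes, so every sequence of moves ends in
  a terminal pipe dream.\<close>

lemma moves_to_bottom:
  assumes n: "1 \<le> n" and w: "w \<in> BC n" and "D \<in> PD n w"
  shows "\<exists>D'. bottom_pipe_dream n w D' \<and> (admissible_move n)\<^sup>*\<^sup>* D D'"
  using assms(3)
proof (induction "weight n D" arbitrary: D rule: less_induct)
  case less
  show ?case
  proof (cases "\<exists>D'. admissible_move n D D'")
    case True
    then obtain D' where D': "admissible_move n D D'" by blast
    then obtain w' where w': "D \<in> PD n w'" "D' \<in> PD n w'" by (auto simp: admissible_move_def)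
    have "w' = w" using w'(1) less.prems by (auto simp: PD_def reduced_word_def word_for_def)
    then have "D' \<in> PD n w" using w' by simp
    then show ?thesis
      using less.hyps[OF weight_less[OF D']] D' by (meson converse_rtranclp_into_rtranclp)
  next
    case False
    obtain K where K: "\<And>k. k > K \<Longrightarrow> \<not> gamma_nonempty n D k"
      using gamma_bound_exists less.prems unfolding PD_def by blast
    have "bottom_pipe_dream n w D"
    proof (rule ascending_imp_bottom[OF n less.prems])
      show "\<not> gamma_nonempty n D k" if "K < k" for k using K that .
      show "asc (word_prod (sig_word D xs)) (box_index b)" if "boxes n K = xs @ b # ys" for xs b ys
        by (rule terminal_asc[OF w less.prems K _ that]) (use False in auto)
    qed
    then show ?thesis by blast
  qed
qed

theorem theorem5p8:
  fixes n :: nat and w :: "int \<Rightarrow> int"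
  assumes "n \<ge> 1" and "w \<in> BC n"
  shows "(\<exists>!D\<^sub>b. bottom_pipe_dream n w D\<^sub>b) \<and>
    (\<forall>D\<^sub>b. bottom_pipe_dream n w D\<^sub>b \<longrightarrow>
      (\<forall>i\<in>{1..n}. stair_row_count n D\<^sub>b i = code_L n w i) \<and>
      (\<forall>j\<ge>1. gamma_count n D\<^sub>b j = code_N n w j) \<and>
      (\<forall>D\<in>PD n w. (admissible_move n)\<^sup>*\<^sup>* D D\<^sub>b))"
proof -
  note counts = bottom_counts[OF assms]
  have unique: "D = D'" if "bottom_pipe_dream n w D" "bottom_pipe_dream n w D'" for D D'
    using bottom_eqI[OF assms(1) that] counts[OF that(1)] counts[OF that(2)] by simp
  obtain D where "D \<in> PD n w" using PD_nonempty[OF assms(2)] by blast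
  then have "\<exists>D. bottom_pipe_dream n w D" using moves_to_bottom[OF assms] by blast
  moreover have "(admissible_move n)\<^sup>*\<^sup>* D D\<^sub>b" if "D \<in> PD n w" "bottom_pipe_dream n w D\<^sub>b" for D D\<^sub>b
    using moves_to_bottom[OF assms that(1)] unique that(2) by blast
  ultimately show ?thesis using unique counts by blast
qed

end
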